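(* Suppose that CGCARE($\Sigma$) admits symmetric solutions, and that for every $x_0\in\mathbb{R}^n$ there exists an input $u(t)\in\mathbb{R}^m$, $t\ge 0$, such that $$J_\infty(x_0,u)=\int_0^\infty \begin{bmatrix} x^{\top}(t) & u^{\top}(t)\end{bmatrix}\begin{bmatrix} Q & S\\ S^{\top} & R\end{bmatrix}\begin{bmatrix} x(t)\\ u(t)\end{bmatrix}dt,\qquad \dot x(t)=Ax(t)+Bu(t),\ x(0)=x_0,$$ is finite. Let $X(t)$, $t\ge0$, be the solution of $$\dot X(t)=X(t)A+A^{\top}X(t)-(S+X(t)B)R^{\dagger}(S^{\top}+B^{\top}X(t))+Q,\qquad X(0)=0.$$ Then: (1) The limit $\bar X=\lim_{t\to\infty}X(t)$ exists and is a solution $\bar X=\bar X^{\top}\ge 0$ of CGCARE($\Sigma$). (2) For every $x_0\in\mathbb{R}^n$, the value of the optimal (minimum) cost of $J_\infty(x_0,u)$ over inputs $u$ is $x_0^{\top}\bar X x_0$. (3) $\bar X$ is the minimum positive semidefinite solution of CGCARE($\Sigma$), i.e. $\bar X\le\tilde X$ for every symmetric positive semidefinite solution $\tilde X$ of CGCARE($\Sigma$). (4) The set of all optimal controls minimising $J_\infty$ can be parameterised as $$u(t)=-R^{\dagger}(S^{\top}+B^{\top}\bar X)\,x(t)+G\,v(t),$$ with arbitrary $v(t)$.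
   Context: Let $A,Q\in\mathbb{R}^{n\times n}$, $B,S\in\mathbb{R}^{n\times m}$, $R\in\mathbb{R}^{m\times m}$, with standing assumption $\Pi=\begin{bmatrix} Q & S\\ S^{\top} & R\end{bmatrix}=\Pi^{\top}\ge 0$ (positive semidefinite; $R$ may be singular). $M^{\dagger}$ denotes the Moore-Penrose pseudo-inverse, and $G=I_m-R^{\dagger}R$ is the orthogonal projector onto $\ker R$. The order $\le$ on symmetric matrices is the positive-semidefinite order. CGCARE($\Sigma$) (constrained generalised continuous algebraic Riccati equation) is the pair of conditions on $X\in\mathbb{R}^{n\times n}$: $$XA+A^{\top}X-(S+XB)R^{\dagger}(S^{\top}+B^{\top}X)+Q=0,\qquad \ker R\subseteq\ker(S+XB).$$ Inputs $u$ and the free signals $v$ are ordinary functions (not distributions), $[0,\infty)\to\mathbb{R}^m$, taken to be locally square-integrable; equalities of inputs are understood almost everywhere (in the $L_2$ sense). *)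

theory Defs
  imports "HOL-Analysis.Analysis"
begin

text \<open>An \<open>n \<times> m\<close> matrix has type \<open>real^'m^'n\<close>. Signals on \<open>[0,\<infinity>)\<close> are functions on \<open>real\<close>
  whose values at negative times are never used.\<close>

definition psd :: "real^'n^'n \<Rightarrow> bool" where
  "psd M \<longleftrightarrow> transpose M = M \<and> (\<forall>x. 0 \<le> x \<bullet> (M *v x))"

definition psd_le :: "real^'n^'n \<Rightarrow> real^'n^'n \<Rightarrow> bool" where
  "psd_le M N \<longleftrightarrow> psd (N - M)"

definition is_pinv :: "real^'c^'r \<Rightarrow> real^'r^'c \<Rightarrow> bool" where
  "is_pinv M P \<longleftrightarrow>
     M ** P ** M = M \<and> P ** M ** P = P \<and>
     transpose (M ** P) = M ** P \<and> transpose (P ** M) = P ** M"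

text \<open>Moore--Penrose pseudo-inverse: the unique solution of the four Penrose equations.\<close>

definition pinv :: "real^'c^'r \<Rightarrow> real^'r^'c" where
  "pinv M = (THE P. is_pinv M P)"

definition mat_ker :: "real^'c^'r \<Rightarrow> (real^'c) set" where
  "mat_ker M = {v. M *v v = 0}"

definition block_vec :: "real^'n \<Rightarrow> real^'m \<Rightarrow> real^('n + 'm)" where
  "block_vec x u = (\<chi> i. case i of Inl a \<Rightarrow> x $ a | Inr b \<Rightarrow> u $ b)"

definition block_mat ::
  "real^'n^'n \<Rightarrow> real^'m^'n \<Rightarrow> real^'n^'m \<Rightarrow> real^'m^'m \<Rightarrow> real^('n + 'm)^('n + 'm)" where
  "block_mat M11 M12 M21 M22 =
     (\<chi> i j. case i of
        Inl a \<Rightarrow> (case j of Inl c \<Rightarrow> M11 $ a $ c | Inr d \<Rightarrow> M12 $ a $ d)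
      | Inr b \<Rightarrow> (case j of Inl c \<Rightarrow> M21 $ b $ c | Inr d \<Rightarrow> M22 $ b $ d))"

definition popov :: "real^'n^'n \<Rightarrow> real^'m^'n \<Rightarrow> real^'m^'m \<Rightarrow> real^('n + 'm)^('n + 'm)" where
  "popov Q S R = block_mat Q S (transpose S) R"

definition riccati_op ::
  "real^'n^'n \<Rightarrow> real^'m^'n \<Rightarrow> real^'n^'n \<Rightarrow> real^'m^'n \<Rightarrow> real^'m^'m \<Rightarrow> real^'n^'n \<Rightarrow> real^'n^'n" where
  "riccati_op A B Q S R X =
     X ** A + transpose A ** X
     - (S + X ** B) ** pinv R ** (transpose S + transpose B ** X) + Q"

definition cgcare ::
  "real^'n^'n \<Rightarrow> real^'m^'n \<Rightarrow> real^'n^'n \<Rightarrow> real^'m^'n \<Rightarrow> real^'m^'m \<Rightarrow> real^'n^'n \<Rightarrow> bool" where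
  "cgcare A B Q S R X \<longleftrightarrow>
     riccati_op A B Q S R X = 0 \<and> mat_ker R \<subseteq> mat_ker (S + X ** B)"

definition riccati_flow ::
  "real^'n^'n \<Rightarrow> real^'m^'n \<Rightarrow> real^'n^'n \<Rightarrow> real^'m^'n \<Rightarrow> real^'m^'m \<Rightarrow> (real \<Rightarrow> real^'n^'n) \<Rightarrow> bool" where
  "riccati_flow A B Q S R X \<longleftrightarrow>
     X 0 = 0 \<and>
     (\<forall>t\<ge>0. (X has_vector_derivative riccati_op A B Q S R (X t)) (at t within {0..}))"

definition locally_square_integrable :: "(real \<Rightarrow> real^'m) \<Rightarrow> bool" where
  "locally_square_integrable u \<longleftrightarrow>
     (\<forall>T\<ge>0. set_borel_measurable lebesgue {0..T} u \<and>
            set_integrable lebesgue {0..T} (\<lambda>t. (norm (u t))\<^sup>2))"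

text \<open>Since \<open>u\<close> is only locally square-integrable, \<open>x' = A x + B u\<close>, \<open>x 0 = x0\<close> is understood in the
  sense of Caratheodory, i.e. as an integral equation. For each \<open>x0\<close> and \<open>u\<close> it determines \<open>x\<close>
  uniquely on \<open>[0,\<infinity>)\<close>.\<close>

definition state_trajectory ::
  "real^'n^'n \<Rightarrow> real^'m^'n \<Rightarrow> real^'n \<Rightarrow> (real \<Rightarrow> real^'m) \<Rightarrow> (real \<Rightarrow> real^'n) \<Rightarrow> bool" where
  "state_trajectory A B x0 u x \<longleftrightarrow>
     (\<forall>t\<ge>0. set_integrable lebesgue {0..t} (\<lambda>s. A *v x s + B *v u s) \<and>
            x t = x0 + (LINT s:{0..t}|lebesgue. A *v x s + B *v u s))"

definition admissible ::
  "real^'n^'n \<Rightarrow> real^'m^'n \<Rightarrow> real^'n \<Rightarrow> (real \<Rightarrow> real^'m) \<Rightarrow> (real \<Rightarrow> real^'n) \<Rightarrow> bool" where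
  "admissible A B x0 u x \<longleftrightarrow> locally_square_integrable u \<and> state_trajectory A B x0 u x"

text \<open>The infinite-horizon cost, with the input \<open>u\<close> paired with the state trajectory \<open>x\<close> it
  generates. It is \<open>ennreal\<close>-valued; no sign information is lost, because the integrand is
  nonnegative whenever \<open>popov Q S R\<close> is positive semidefinite.\<close>

definition J_infty ::
  "real^'n^'n \<Rightarrow> real^'m^'n \<Rightarrow> real^'m^'m \<Rightarrow> (real \<Rightarrow> real^'n) \<Rightarrow> (real \<Rightarrow> real^'m) \<Rightarrow> ennreal" where
  "J_infty Q S R x u =
     (\<integral>\<^sup>+ t\<in>{0..}. ennreal (block_vec (x t) (u t) \<bullet> (popov Q S R *v block_vec (x t) (u t))) \<partial>lebesgue)"

definition optimal_control ::
  "real^'n^'n \<Rightarrow> real^'m^'n \<Rightarrow> real^'n^'n \<Rightarrow> real^'m^'n \<Rightarrow> real^'m^'m \<Rightarrow> real^'n \<Rightarrow>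
   (real \<Rightarrow> real^'m) \<Rightarrow> bool" where
  "optimal_control A B Q S R x0 u \<longleftrightarrow>
     (\<exists>x. admissible A B x0 u x \<and>
          (\<forall>u' x'. admissible A B x0 u' x' \<longrightarrow> J_infty Q S R x u \<le> J_infty Q S R x' u'))"

text \<open>\<open>u\<close> is generated by the feedback law \<open>u = - R\<^sup>\<dagger> (S\<^sup>T + B\<^sup>T X) x + G v\<close> with \<open>G = I - R\<^sup>\<dagger> R\<close>,
  where \<open>x\<close> is the state trajectory of \<open>u\<close> itself; inputs are identified almost everywhere.\<close>

definition feedback_control ::
  "real^'n^'n \<Rightarrow> real^'m^'n \<Rightarrow> real^'m^'n \<Rightarrow> real^'m^'m \<Rightarrow> real^'n^'n \<Rightarrow> real^'n \<Rightarrow>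
   (real \<Rightarrow> real^'m) \<Rightarrow> (real \<Rightarrow> real^'m) \<Rightarrow> bool" where
  "feedback_control A B S R X x0 v u \<longleftrightarrow>
     (\<exists>x. admissible A B x0 u x \<and>
          (AE t in lebesgue. 0 \<le> t \<longrightarrow>
             u t = - (pinv R ** (transpose S + transpose B ** X)) *v x t
                   + (mat 1 - pinv R ** R) *v v t))"

end

(* Let A0 = A - B R^+ S^T, N = B R^+ B^T and Q0 = Q - S R^+ S^T. The flow is X = V U^-1 for the linear
   Hamiltonian system U' = N V - A0 U, V' = Q0 U + A0^T V, U(0) = I, V(0) = 0; U stays invertible because
   (U z) . (V z) has a nonnegative derivative, and the conserved Hamiltonian of the system shows X' >= 0.
   A symmetric solution of CGCARE forces ker R to lie in ker (S + X(t) B), so squares can be completed with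
   X(T - t): this gives J(x0, u) >= x0^T X(t) x0, hence X is bounded and converges to a solution Xbar.
   Completing squares with a constant psd solution Y of CGCARE shows that the feedback of Y costs at most
   x0^T Y x0, and with Xbar that every control costs at least x0^T Xbar x0 plus the integral of w^T R w,
   w = u + R^+ (S^T + B^T Xbar) x; hence Xbar is minimal and the optimal controls are those with R w = 0. *)
theory Submission
  imports Defs
begin

section \<open>Matrices and the pseudo-inverse of a symmetric matrix\<close>

text \<open>Inputs are only locally square-integrable, so trajectories are merely absolutely
  continuous and squares have to be integrated without pointwise derivatives;
  \<open>antiderivative_on_prod\<close> serves this purpose. Because \<open>R\<close> may be
  singular, the square (u + R^+ l)^T R (u + R^+ l) with l = (S + X B)^T x reproduces the cross term
  2 l^T u for all x and u only if ker R lies in ker (S + X B). This is why the kernel condition has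
  to be carried along the flow. The feedback need not be stabilising, so neither cost bound may rely
  on x(T) tending to 0. In the upper bound the terminal term x(T)^T Y x(T) is dropped because Y is
  positive semidefinite. In the lower bound it cancels: the cost incurred after T is at least x(T)^T
  X(r) x(T) for every r, and r tends to infinity while T stays fixed. What remains is the integral
  of w^T R w over [0, T], bounded by the excess cost for every T.\<close>

lemma bounded_bilinear_matrix_matrix_mult:
  "bounded_bilinear ((**) :: real^'b^'a \<Rightarrow> real^'c^'b \<Rightarrow> real^'c^'a)"
  unfolding bilinear_conv_bounded_bilinear[symmetric] bilinear_def
  by (auto intro!: linearI simp: matrix_matrix_mult_def vec_eq_iff sum.distrib sum_distrib_left algebra_simps)

lemma bounded_bilinear_matrix_vector_mult:
  "bounded_bilinear ((*v) :: real^'b^'a \<Rightarrow> real^'b \<Rightarrow> real^'a)"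
  unfolding bilinear_conv_bounded_bilinear[symmetric] bilinear_def
  by (auto intro!: linearI simp: matrix_vector_mult_def vec_eq_iff sum.distrib sum_distrib_left algebra_simps)

interpretation mm: bounded_bilinear "(**) :: real^'b^'a \<Rightarrow> real^'c^'b \<Rightarrow> real^'c^'a"
  by (rule bounded_bilinear_matrix_matrix_mult)

interpretation mv: bounded_bilinear "(*v) :: real^'b^'a \<Rightarrow> real^'b \<Rightarrow> real^'a"
  by (rule bounded_bilinear_matrix_vector_mult)

lemmas matrix_algebra = matrix_mul_assoc matrix_vector_mul_assoc mm.add_left mm.add_right mm.diff_left mm.diff_right
  mm.minus_left mm.minus_right mv.add_left mv.add_right mv.diff_left mv.diff_right
  mv.minus_left mv.minus_right

lemma transpose_add: "transpose (M + N) = transpose M + transpose (N :: real^'b^'a)"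
  by (simp add: transpose_def vec_eq_iff)

lemma transpose_diff: "transpose (M - N) = transpose M - transpose (N :: real^'b^'a)"
  by (simp add: transpose_def vec_eq_iff)

lemma transpose_zero: "transpose (0 :: real^'b^'a) = 0"
  by (simp add: transpose_def vec_eq_iff)

lemma bounded_linear_transpose: "bounded_linear (transpose :: real^'b^'a \<Rightarrow> real^'a^'b)"
  unfolding linear_conv_bounded_linear[symmetric]
  by (auto intro!: linearI simp: transpose_def vec_eq_iff)

lemma matrix_eq_inner: "M = N \<longleftrightarrow> (\<forall>x y. x \<bullet> (M *v y) = x \<bullet> (N *v y))"
  for M N :: "real^'b^'a"
  by (metis matrix_eq vector_eq_ldot)

lemma inner_transpose_left: "(transpose M *v x) \<bullet> y = x \<bullet> (M *v y)" for M :: "real^'b^'a"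
  by (metis dot_lmul_matrix transpose_transpose vector_transpose_matrix transpose_matrix_vector)

lemma inner_symmetric_swap:
  "transpose M = M \<Longrightarrow> (M *v x) \<bullet> y = x \<bullet> (M *v y)" for M :: "real^'a^'a"
  by (metis inner_transpose_left)

lemma affine_nonneg_imp_zero:
  fixes a b :: real
  assumes "\<And>c. 0 \<le> a + c * b"
  shows "b = 0"
proof (rule ccontr)
  assume "b \<noteq> 0"
  \<comment> \<open>This \<open>c\<close> gives the affine function the value -1.\<close>
  then show False using assms[of "- (a + 1) / b"] by (simp add: field_simps)
qed

text \<open>Along the line y + c x with y = M x the quadratic form has no c^2 term, so it is affine
  in c with slope 2 |M x|^2; being nonnegative for all c, it has slope 0.\<close>

lemma psd_quadratic_zero:
  fixes M :: "real^'a^'a"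
  assumes "psd M" "x \<bullet> (M *v x) = 0"
  shows "M *v x = 0"
proof -
  have sym: "transpose M = M" and nn: "\<And>x. 0 \<le> x \<bullet> (M *v x)" using assms(1) by (auto simp: psd_def)
  let ?y = "M *v x"
  have "0 \<le> ?y \<bullet> (M *v ?y) + c * (2 * (?y \<bullet> ?y))" for c
  proof -
    have "0 \<le> (?y + c *\<^sub>R x) \<bullet> (M *v (?y + c *\<^sub>R x))" by (rule nn)
    also have "\<dots> = ?y \<bullet> (M *v ?y) + c * (2 * (?y \<bullet> ?y))"
      using assms(2) inner_symmetric_swap[OF sym, of x ?y]
      by (simp add: mv.add_right mv.scaleR_right inner_add_left inner_add_right algebra_simps)
    finally show ?thesis .
  qed
  then have "2 * (?y \<bullet> ?y) = 0" by (rule affine_nonneg_imp_zero)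
  then show ?thesis by simp
qed

text \<open>\<open>M ** P\<close> and \<open>M ** P'\<close> are symmetric projectors with the same
  range, hence equal, and likewise \<open>P ** M\<close> and \<open>P' ** M\<close>. Then P = P M P
  = P M P' = P' M P' = P'.\<close>

lemma is_pinv_unique:
  assumes "is_pinv M P" "is_pinv M P'"
  shows "P = P'"
proof -
  have M: "M ** P ** M = M" "M ** P' ** M = M" and P: "P ** M ** P = P" "P' ** M ** P' = P'"
    and s: "transpose (M ** P) = M ** P" "transpose (P ** M) = P ** M"
      "transpose (M ** P') = M ** P'" "transpose (P' ** M) = P' ** M"
    using assms by (auto simp: is_pinv_def)
  have "M ** P = (M ** P') ** (M ** P)" using M(2) by (simp add: matrix_mul_assoc)
  also have "\<dots> = transpose ((M ** P) ** (M ** P'))" by (metis matrix_transpose_mul s)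
  also have "\<dots> = M ** P'" using M(1) s(3) by (simp add: matrix_mul_assoc)
  finally have 1: "M ** P = M ** P'" .
  have "P ** M = (P ** M) ** (P' ** M)" using M(2) by (metis matrix_mul_assoc)
  also have "\<dots> = transpose ((P' ** M) ** (P ** M))" by (metis matrix_transpose_mul s)
  also have "\<dots> = P' ** M" using M(1) s(4) by (metis matrix_mul_assoc)
  finally have 2: "P ** M = P' ** M" .
  show ?thesis using 1 2 P by (metis matrix_mul_assoc)
qed

text \<open>The projector is v -> sum of (b . v) b over an orthonormal basis of V; symmetry is
  visible from this formula.\<close>

lemma orthogonal_projector_ex:
  fixes V :: "(real^'a) set"
  assumes "subspace V"
  obtains E :: "real^'a^'a" where "transpose E = E" "\<And>v. E *v v \<in> V" "\<And>v. v \<in> V \<Longrightarrow> E *v v = v"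
proof -
  obtain B where B: "B \<subseteq> V" "pairwise orthogonal B" "\<And>x. x \<in> B \<Longrightarrow> norm x = 1" "independent B" "span B = V"
    using orthonormal_basis_subspace[OF assms] by metis
  have fin: "finite B" using B(4) independent_imp_finite by blast
  define P where "P v = (\<Sum>b\<in>B. (b \<bullet> v) *\<^sub>R b)" for v
  have lin: "linear P"
    unfolding P_def by (rule linearI) (simp_all add: inner_add_right scaleR_add_left sum.distrib scaleR_sum_right)
  have self: "P v = v" if "v \<in> V" for v
  proof -
    have "v \<in> span B" using that B(5) by simp
    then show ?thesis
    proof (induction rule: span_induct)
      case base
      show ?case by (auto simp: subspace_def linear_0[OF lin] linear_add[OF lin] linear_scale[OF lin])
    next
      case (step b)
      have "P b = (\<Sum>c\<in>B. if c = b then b else 0)"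
        unfolding P_def
      proof (rule sum.cong[OF refl])
        fix c assume "c \<in> B"
        show "(c \<bullet> b) *\<^sub>R c = (if c = b then b else 0)"
          using B(2,3) step \<open>c \<in> B\<close>
          by (auto simp: pairwise_def orthogonal_def norm_eq_1)
      qed
      then show ?case using step fin by simp
    qed
  qed
  have mP: "matrix P *v x = P x" for x
    using lin by (simp add: matrix_works linear_matrix_vector_mul_eq)
  have "transpose (matrix P) = matrix P"
  proof -
    have "(x \<bullet> P y) = (P x \<bullet> y)" for x y
      by (simp add: P_def inner_sum_right inner_sum_left inner_commute mult.commute)
    then have "x \<bullet> (transpose (matrix P) *v y) = x \<bullet> (matrix P *v y)" for x y
      using inner_transpose_left[of "matrix P" y x] by (simp add: mP inner_commute)
    then show ?thesis by (simp add: matrix_eq_inner)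
  qed
  moreover have "P v \<in> V" for v
    unfolding P_def using B(1) assms by (intro subspace_sum subspace_scale) auto
  ultimately show ?thesis using that[of "matrix P"] self by (simp add: mP)
qed

text \<open>With \<open>E\<close> the orthogonal projector onto \<open>ker M\<close>, the matrix \<open>M + E\<close> is invertible and
  \<open>(M + E)\<^sup>-\<^sup>1 - E\<close> is the pseudo-inverse.\<close>

lemma is_pinv_ex_symmetric:
  fixes M :: "real^'a^'a"
  assumes sym: "transpose M = M"
  shows "\<exists>P. is_pinv M P"
proof -
  obtain E :: "real^'a^'a" where E: "transpose E = E" "\<And>v. E *v v \<in> mat_ker M"
    "\<And>v. v \<in> mat_ker M \<Longrightarrow> E *v v = v"
    by (rule orthogonal_projector_ex[of "mat_ker M"])
       (auto simp: subspace_def mat_ker_def mv.add_right mv.scaleR_right)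
  have ME: "M ** E = 0" using E(2) by (simp add: matrix_eq mat_ker_def flip: matrix_vector_mul_assoc)
  have EM: "E ** M = 0" using ME sym E(1)
    by (metis matrix_transpose_mul transpose_zero mm.zero_left)
  have EE: "E ** E = E" using E by (simp add: matrix_eq flip: matrix_vector_mul_assoc)
  \<comment> \<open>Since E M = 0 and E E = E, applying E to (M + E) v = 0 isolates E v = 0. Then M
    v = 0 as well, so v lies in ker M, where E is the identity.\<close>
  have "v = 0" if "(M + E) *v v = 0" for v
  proof -
    have "E *v ((M + E) *v v) = E *v v" by (simp add: matrix_algebra EM EE)
    then have Ev: "E *v v = 0" using that by simp
    then have "M *v v = 0" using that by (simp add: mv.add_left)
    then show "v = 0" using E(3) Ev by (simp add: mat_ker_def)
  qed
  then obtain W where W: "W ** (M + E) = mat 1"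
    using matrix_left_invertible_ker[of "M + E"] by blast
  then have W': "(M + E) ** W = mat 1" using matrix_left_right_inverse by blast
  have MW: "M ** W = mat 1 - E"
  proof -
    have "(mat 1 - E) ** (M + E) = M" by (simp add: matrix_algebra EM EE)
    then show ?thesis by (metis W' matrix_mul_assoc matrix_mul_rid)
  qed
  have WM: "W ** M = mat 1 - E"
  proof -
    have "(M + E) ** (mat 1 - E) = M" by (simp add: matrix_algebra ME EE)
    then show ?thesis by (metis W matrix_mul_assoc matrix_mul_lid)
  qed
  have EW: "E ** W = E"
  proof -
    have "E ** (M + E) = E" by (simp add: matrix_algebra EM EE)
    then show ?thesis by (metis W' matrix_mul_assoc matrix_mul_rid)
  qed
  have "is_pinv M (W - E)"
    unfolding is_pinv_def
    by (simp add: mm.diff_left mm.diff_right MW WM ME EM EE EW transpose_diff E(1))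
  then show ?thesis ..
qed

lemma is_pinv_pinv_symmetric: "transpose M = M \<Longrightarrow> is_pinv M (pinv M)"
  unfolding pinv_def using is_pinv_ex_symmetric is_pinv_unique by (metis theI')

text \<open>Transposing the four Penrose equations of a symmetric M exchanges the roles of
  \<open>M ** P\<close> and \<open>P ** M\<close>, so the transpose of P solves them too.\<close>

lemma transpose_pinv_symmetric:
  assumes "transpose M = M"
  shows "transpose (pinv M) = pinv M"
proof (rule is_pinv_unique)
  show "is_pinv M (pinv M)" by (rule is_pinv_pinv_symmetric[OF assms])
  then show "is_pinv M (transpose (pinv M))"
    unfolding is_pinv_def by (metis assms matrix_mul_assoc matrix_transpose_mul transpose_transpose)
qed

text \<open>From P = P M P and the symmetry of P, the form of P at x is the form of M at P
  x.\<close>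

lemma psd_pinv:
  assumes "psd M"
  shows "psd (pinv M)"
proof -
  have sym: "transpose M = M" using assms by (simp add: psd_def)
  have "x \<bullet> (pinv M *v x) = (pinv M *v x) \<bullet> (M *v (pinv M *v x))" for x
    using is_pinv_pinv_symmetric[OF sym] transpose_pinv_symmetric[OF sym]
    by (metis inner_symmetric_swap is_pinv_def matrix_vector_mul_assoc)
  then show ?thesis using assms transpose_pinv_symmetric[OF sym] by (simp add: psd_def)
qed

section \<open>Linear differential equations and indefinite integrals\<close>

text \<open>Energy argument: by Cauchy-Schwarz exp(-2 L t) |f t|^2 has a nonpositive derivative, and
  it is 0 at the left end.\<close>

lemma gronwall_zero:
  fixes f :: "real \<Rightarrow> 'a::real_inner"
  assumes der: "\<And>t. t \<in> {a..b} \<Longrightarrow> (f has_vector_derivative f' t) (at t within {a..b})"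
    and bound: "\<And>t. t \<in> {a..b} \<Longrightarrow> norm (f' t) \<le> L * norm (f t)"
    and "f a = 0" "t \<in> {a..b}"
  shows "f t = 0"
proof -
  define g where "g t = exp (- 2 * L * t) * (f t \<bullet> f t)" for t
  have "\<exists>s\<in>{a..t}. g t - g a = (\<lambda>h. h * (exp (- 2 * L * s) * (2 * (f s \<bullet> f' s) - 2 * L * (f s \<bullet> f s)))) (t - a)"
  proof (rule mvt_very_simple)
    show "a \<le> t" using assms(4) by simp
    fix s assume s: "a \<le> s" "s \<le> t"
    have 1: "(f has_derivative (\<lambda>h. h *\<^sub>R f' s)) (at s within {a..t})"
      using has_vector_derivative_within_subset[OF der, of s "{a..t}"] s assms(4)
      by (auto simp: has_vector_derivative_def)
    have "(g has_derivative (\<lambda>h. exp (- 2 * L * s) * (f s \<bullet> (h *\<^sub>R f' s) + (h *\<^sub>R f' s) \<bullet> f s)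
        + (exp (- 2 * L * s) * (- 2 * L * h)) * (f s \<bullet> f s))) (at s within {a..t})"
      unfolding g_def by (auto intro!: derivative_eq_intros 1 simp: algebra_simps)
    then show "(g has_derivative (\<lambda>h. h * (exp (- 2 * L * s) * (2 * (f s \<bullet> f' s) - 2 * L * (f s \<bullet> f s)))))
        (at s within {a..t})"
      by (rule has_derivative_eq_rhs) (auto simp: algebra_simps inner_commute)
  qed
  then obtain s where s: "s \<in> {a..t}"
    "g t - g a = (t - a) * (exp (- 2 * L * s) * (2 * (f s \<bullet> f' s) - 2 * L * (f s \<bullet> f s)))" by auto
  have "f s \<bullet> f' s \<le> norm (f s) * norm (f' s)" by (rule norm_cauchy_schwarz)
  also have "\<dots> \<le> norm (f s) * (L * norm (f s))"
    using bound[of s] s assms(4) by (intro mult_left_mono) auto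
  also have "\<dots> = L * (f s \<bullet> f s)" by (simp add: dot_square_norm power2_eq_square)
  finally have "2 * (f s \<bullet> f' s) - 2 * L * (f s \<bullet> f s) \<le> 0" by simp
  then have "(t - a) * (exp (- 2 * L * s) * (2 * (f s \<bullet> f' s) - 2 * L * (f s \<bullet> f s))) \<le> 0"
    using assms(4) by (intro mult_nonneg_nonpos) auto
  then have "g t \<le> 0" using s(2) \<open>f a = 0\<close> by (simp add: g_def)
  then have "f t \<bullet> f t \<le> 0" by (simp add: g_def mult_le_0_iff)
  then have "f t \<bullet> f t = 0" using inner_ge_zero[of "f t"] by linarith
  then show ?thesis by (simp only: inner_eq_zero_iff)
qed

text \<open>The reflection t -> a + b - t exchanges the end points and changes only the sign of the
  derivative.\<close>

lemma gronwall_zero_backwards: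
  fixes f :: "real \<Rightarrow> 'a::real_inner"
  assumes der: "\<And>t. t \<in> {a..b} \<Longrightarrow> (f has_vector_derivative f' t) (at t within {a..b})"
    and bound: "\<And>t. t \<in> {a..b} \<Longrightarrow> norm (f' t) \<le> L * norm (f t)"
    and "f b = 0" "t \<in> {a..b}"
  shows "f t = 0"
proof -
  have "f (a + b - (a + b - t)) = 0"
  proof (rule gronwall_zero[where f = "\<lambda>t. f (a + b - t)" and t = "a + b - t" and f' = "\<lambda>t. - f' (a + b - t)" and a = a and b = b and L = L])
    fix t assume t: "t \<in> {a..b}"
    have "((\<lambda>t. a + b - t) has_real_derivative -1) (at t within {a..b})"
      by (auto intro!: derivative_eq_intros)
    moreover have "(f has_vector_derivative f' (a + b - t)) (at (a + b - t) within (\<lambda>t. a + b - t) ` {a..b})"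
      using t by (intro has_vector_derivative_within_subset[OF der]) auto
    ultimately have "(f \<circ> (\<lambda>t. a + b - t) has_vector_derivative - 1 *\<^sub>R f' (a + b - t)) (at t within {a..b})"
      by (intro vector_diff_chain_within) (auto simp: has_real_derivative_iff_has_vector_derivative)
    then show "((\<lambda>t. f (a + b - t)) has_vector_derivative - f' (a + b - t)) (at t within {a..b})"
      by (simp add: o_def)
  qed (use assms in auto)
  then show ?thesis by simp
qed

text \<open>The solution is the exponential series with terms t^n / n! F^n y0. It is treated
  coordinate by coordinate as a real power series, so that termwise differentiation of scalar series
  applies; the domination by the exponential series of K |t| makes each coordinate converge
  everywhere.\<close>

lemma linear_ode_ex:
  fixes F :: "'a::euclidean_space \<Rightarrow> 'a"
  assumes "bounded_linear F"
  shows "\<exists>y. y 0 = y0 \<and> (\<forall>t. (y has_vector_derivative F (y t)) (at t))"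
proof -
  obtain K where K: "\<And>x. norm (F x) \<le> norm x * K" "K \<ge> 0"
    using bounded_linear.nonneg_bounded[OF assms] by blast
  define v where "v n = (F ^^ n) y0" for n
  have v_bound: "norm (v n) \<le> K ^ n * norm y0" for n
  proof (induction n)
    case (Suc n)
    have "norm (v (Suc n)) \<le> norm (v n) * K" using K(1) by (simp add: v_def)
    also have "\<dots> \<le> (K ^ n * norm y0) * K" using Suc K(2) by (rule mult_right_mono)
    finally show ?case by (simp add: ac_simps)
  qed (simp add: v_def)
  define c where "c b n = (v n \<bullet> b) / fact n" for b n
  have summ: "summable (\<lambda>n. c b n * t ^ n)" if "b \<in> Basis" for b t
  proof (rule summable_comparison_test')
    show "summable (\<lambda>n. norm y0 * (inverse (fact n) * (K * \<bar>t\<bar>) ^ n))"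
      by (intro summable_mult summable_exp)
    fix n :: nat
    have "\<bar>v n \<bullet> b\<bar> \<le> K ^ n * norm y0"
      using Basis_le_norm[OF that, of "v n"] v_bound[of n] by linarith
    then have "\<bar>v n \<bullet> b\<bar> * (\<bar>t\<bar> ^ n / fact n) \<le> K ^ n * norm y0 * (\<bar>t\<bar> ^ n / fact n)"
      by (rule mult_right_mono) simp
    then show "norm (c b n * t ^ n) \<le> norm y0 * (inverse (fact n) * (K * \<bar>t\<bar>) ^ n)"
      by (simp add: c_def abs_mult power_abs power_mult_distrib field_simps)
  qed
  define y where "y t = (\<Sum>b\<in>Basis. (\<Sum>n. c b n * t ^ n) *\<^sub>R b)" for t :: real
  have y_inner: "y t \<bullet> b = (\<Sum>n. c b n * t ^ n)" if "b \<in> Basis" for b t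
    using that by (simp add: y_def inner_sum_left_Basis)
  have y_sums: "(\<lambda>n. (t ^ n / fact n) *\<^sub>R v n) sums y t" for t
  proof -
    have "(\<lambda>n. \<Sum>b\<in>Basis. (c b n * t ^ n) *\<^sub>R b) sums y t"
      unfolding y_def by (intro sums_sum sums_scaleR_left summable_sums summ)
    moreover have "(\<Sum>b\<in>Basis. (c b n * t ^ n) *\<^sub>R b) = (t ^ n / fact n) *\<^sub>R v n" for n
    proof -
      have "(t ^ n / fact n) *\<^sub>R v n = (\<Sum>b\<in>Basis. (((t ^ n / fact n) *\<^sub>R v n) \<bullet> b) *\<^sub>R b)"
        by (rule euclidean_representation[symmetric])
      then show ?thesis by (simp add: c_def mult.commute)
    qed
    ultimately show ?thesis by simp
  qed
  have F_sums: "(\<lambda>n. (t ^ n / fact n) *\<^sub>R v (Suc n)) sums F (y t)" for t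
    using bounded_linear.sums[OF assms y_sums[of t]]
    by (simp add: v_def linear_simps[OF assms])
  have F_inner: "F (y t) \<bullet> b = (\<Sum>n. diffs (c b) n * t ^ n)" for b t
  proof -
    have "(\<lambda>n. ((t ^ n / fact n) *\<^sub>R v (Suc n)) \<bullet> b) sums (F (y t) \<bullet> b)"
      by (rule bounded_linear.sums[OF bounded_linear_inner_left F_sums])
    moreover have "((t ^ n / fact n) *\<^sub>R v (Suc n)) \<bullet> b = diffs (c b) n * t ^ n" for n
      by (simp add: diffs_def c_def fact_Suc field_simps del: of_nat_Suc)
    ultimately show ?thesis by (simp add: sums_iff)
  qed
  have "(y has_vector_derivative F (y t)) (at t)" for t
    unfolding has_vector_derivative_def
  proof (subst has_derivative_componentwise_within, intro ballI)
    fix b :: 'a assume b: "b \<in> Basis"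
    have "((\<lambda>t. y t \<bullet> b) has_real_derivative F (y t) \<bullet> b) (at t)"
      unfolding y_inner[OF b] F_inner
      by (rule termdiffs_strong_converges_everywhere) (rule summ[OF b])
    then show "((\<lambda>t. y t \<bullet> b) has_derivative (\<lambda>h. (h *\<^sub>R F (y t)) \<bullet> b)) (at t)"
      by (simp add: has_field_derivative_def mult.commute[of _ "F (y t) \<bullet> b"])
  qed
  moreover have "y 0 = y0"
  proof -
    have "(\<lambda>n. (0 ^ n / fact n) *\<^sub>R v n) = (\<lambda>n. if n = 0 then v 0 else 0)" by (auto simp: fun_eq_iff)
    then have "(\<lambda>n. if n = 0 then v 0 else 0) sums y 0" using y_sums[of 0] by simp
    from sums_unique2[OF this sums_single[of 0 "\<lambda>_. v 0"]] show ?thesis by (simp add: v_def)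
  qed
  ultimately show ?thesis by blast
qed

section \<open>Absolutely continuous functions on [0, T] and their product rule\<close>

text \<open>Absolute continuity with almost-everywhere derivative \<open>f\<close>, encoded by the
  integral equation. Caratheodory trajectories have exactly this form.\<close>

definition antiderivative_on :: "real \<Rightarrow> (real \<Rightarrow> 'a::euclidean_space) \<Rightarrow> (real \<Rightarrow> 'a) \<Rightarrow> bool" where
  "antiderivative_on T F f \<longleftrightarrow>
     f absolutely_integrable_on {0..T} \<and> (\<forall>t\<in>{0..T}. F t = F 0 + integral {0..t} f)"

lemma antiderivative_onD:
  "antiderivative_on T F f \<Longrightarrow> 0 \<le> t \<Longrightarrow> t \<le> T \<Longrightarrow> F t = F 0 + integral {0..t} f"
  unfolding antiderivative_on_def by (metis atLeastAtMost_iff)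

lemma antiderivative_on_integrable:
  "antiderivative_on T F f \<Longrightarrow> 0 \<le> s \<Longrightarrow> t \<le> T \<Longrightarrow> f absolutely_integrable_on {s..t}"
  unfolding antiderivative_on_def by (elim conjE, erule set_integrable_subset) auto

lemma antiderivative_on_diff:
  assumes "antiderivative_on T F f" "0 \<le> s" "s \<le> t" "t \<le> T"
  shows "F t - F s = integral {s..t} f"
proof -
  have "f integrable_on {0..t}"
    using antiderivative_on_integrable[OF assms(1), of 0 t] assms(4) set_lebesgue_integral_eq_integral(1) by blast
  then have "integral {0..s} f + integral {s..t} f = integral {0..t} f"
    using assms by (intro Henstock_Kurzweil_Integration.integral_combine) auto
  moreover have "F s = F 0 + integral {0..s} f" "F t = F 0 + integral {0..t} f"
    using assms by (auto intro: antiderivative_onD)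
  ultimately show ?thesis by (metis add_diff_cancel_left add_diff_cancel_left')
qed

lemma antiderivative_on_continuous:
  assumes "antiderivative_on T F f"
  shows "continuous_on {0..T} F"
proof -
  have "f integrable_on {0..T}"
    using assms set_lebesgue_integral_eq_integral(1) antiderivative_on_integrable by blast
  then have "continuous_on {0..T} (\<lambda>t. F 0 + integral {0..t} f)"
    by (intro continuous_intros indefinite_integral_continuous_1)
  then show ?thesis
    by (rule continuous_on_eq) (metis assms antiderivative_on_def)
qed

lemma antiderivative_on_C1:
  assumes "\<And>t. t \<in> {0..T} \<Longrightarrow> (F has_vector_derivative f t) (at t within {0..T})"
    and "continuous_on {0..T} f"
  shows "antiderivative_on T F f"
  unfolding antiderivative_on_def
proof
  show "f absolutely_integrable_on {0..T}" by (rule absolutely_integrable_continuous_real) fact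
  show "\<forall>t\<in>{0..T}. F t = F 0 + integral {0..t} f"
  proof
    fix t assume t: "t \<in> {0..T}"
    have "(f has_integral F t - F 0) {0..t}"
      using t by (intro fundamental_theorem_of_calculus has_vector_derivative_within_subset[OF assms(1)]) auto
    then show "F t = F 0 + integral {0..t} f" by (simp add: integral_unique)
  qed
qed

text \<open>Bisecting at the midpoint value of \<open>m\<close> halves the bound on the increment of \<open>H\<close>.\<close>

lemma eq_endpoints_if_square_increment:
  fixes H :: "real \<Rightarrow> 'a::real_normed_vector" and m :: "real \<Rightarrow> real"
  assumes cont: "continuous_on {a..b} m"
    and mono: "\<And>s t. a \<le> s \<Longrightarrow> s \<le> t \<Longrightarrow> t \<le> b \<Longrightarrow> m s \<le> m t"
    and incr: "\<And>s t. a \<le> s \<Longrightarrow> s \<le> t \<Longrightarrow> t \<le> b \<Longrightarrow> norm (H t - H s) \<le> C * (m t - m s)\<^sup>2"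
    and "a \<le> b"
  shows "H b = H a"
proof -
  have *: "norm (H t - H s) \<le> C * (m t - m s)\<^sup>2 / 2 ^ n" if "a \<le> s" "s \<le> t" "t \<le> b" for n s t
    using that
  proof (induction n arbitrary: s t)
    case 0
    then show ?case using incr by simp
  next
    case (Suc n)
    have "m s \<le> m t" using mono Suc.prems by simp
    then obtain r where r: "s \<le> r" "r \<le> t" "m r = (m s + m t) / 2"
      using IVT'[of m s "(m s + m t) / 2" t] Suc.prems continuous_on_subset[OF cont, of "{s..t}"] by auto
    have "norm (H t - H s) \<le> norm (H t - H r) + norm (H r - H s)" by norm
    also have "\<dots> \<le> C * (m t - m r)\<^sup>2 / 2 ^ n + C * (m r - m s)\<^sup>2 / 2 ^ n"
      using Suc r by (intro add_mono) auto
    \<comment> \<open>Two squares of half the increment of \<open>m\<close> add up to half the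
      square of the whole increment.\<close>
    also have "\<dots> = C * (m t - m s)\<^sup>2 / 2 ^ Suc n"
      unfolding r(3) by (simp add: field_simps power2_eq_square)
    finally show ?case .
  qed
  have "(\<lambda>n. C * (m b - m a)\<^sup>2 * (1 / 2) ^ n) \<longlonglongrightarrow> C * (m b - m a)\<^sup>2 * 0"
    by (intro tendsto_intros LIMSEQ_realpow_zero) auto
  moreover have "norm (H b - H a) \<le> C * (m b - m a)\<^sup>2 * (1 / 2) ^ n" for n
    using *[of a b n] \<open>a \<le> b\<close> by (simp add: power_divide)
  ultimately have "norm (H b - H a) \<le> 0"
    using LIMSEQ_le_const by (metis (no_types, lifting) mult_zero_right)
  then show ?thesis by simp
qed

text \<open>Differentiation almost everywhere is avoided. The defect \<open>H\<close> between the
  product and the integral of its expected derivative changes over [s, t] by at most a constant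
  times the square of the increment of a continuous monotone function \<open>m\<close>, which forces
  \<open>H\<close> to be constant.\<close>

lemma antiderivative_on_prod:
  fixes prod :: "'a::euclidean_space \<Rightarrow> 'b::euclidean_space \<Rightarrow> 'c::euclidean_space"
  assumes bil: "bounded_bilinear prod" and F: "antiderivative_on T F f" and G: "antiderivative_on T G g"
  shows "antiderivative_on T (\<lambda>t. prod (F t) (G t)) (\<lambda>t. prod (F t) (g t) + prod (f t) (G t))"
proof -
  interpret bounded_bilinear prod by fact
  define k where "k t = prod (F t) (g t) + prod (f t) (G t)" for t
  note contF = antiderivative_on_continuous[OF F] and contG = antiderivative_on_continuous[OF G]
  obtain C where C: "0 \<le> C" "\<And>x y. norm (prod x y) \<le> norm x * norm y * C" using nonneg_bounded by blast
  have I: "{s..t} \<in> sets lebesgue" for s t :: real by simp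
  have abs1: "(\<lambda>r. prod (P r) (q r)) absolutely_integrable_on {s..t}"
    if "continuous_on {s..t} P" "q absolutely_integrable_on {s..t}" for P q and s t :: real
  proof (rule absolutely_integrable_bounded_measurable_product[where h = prod])
    show "bilinear prod" by (simp add: bilinear_conv_bounded_bilinear bil)
    show "P \<in> borel_measurable (lebesgue_on {s..t})"
      by (rule continuous_imp_measurable_on_sets_lebesgue[OF that(1) I])
    show "bounded (P ` {s..t})" using that(1) by (intro compact_imp_bounded compact_continuous_image) auto
  qed (use that in auto)
  have bil': "bounded_bilinear (\<lambda>y x. prod x y)" by (rule flip)
  have abs2: "(\<lambda>r. prod (q r) (P r)) absolutely_integrable_on {s..t}"
    if "continuous_on {s..t} P" "q absolutely_integrable_on {s..t}" for P q and s t :: real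
  proof (rule absolutely_integrable_bounded_measurable_product[where h = "\<lambda>y x. prod x y"])
    show "bilinear (\<lambda>y x. prod x y)" by (simp add: bilinear_conv_bounded_bilinear bil')
    show "P \<in> borel_measurable (lebesgue_on {s..t})"
      by (rule continuous_imp_measurable_on_sets_lebesgue[OF that(1) I])
    show "bounded (P ` {s..t})" using that(1) by (intro compact_imp_bounded compact_continuous_image) auto
  qed (use that in auto)
  have k: "k absolutely_integrable_on {0..T}"
    unfolding k_def using F G contF contG by (intro set_integral_add abs1 abs2) (auto intro: antiderivative_on_integrable)
  \<comment> \<open>Dominating both derivatives by one function lets a single \<open>m\<close>
    control the increments of \<open>F\<close> and \<open>G\<close>.\<close>
  define e where "e r = norm (f r) + norm (g r)" for r
  have e: "e absolutely_integrable_on {0..T}"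
    unfolding e_def using F G by (intro set_integral_add set_integrable_norm) (auto intro: antiderivative_on_integrable)
  have sub: "q integrable_on {s..t}" if "q absolutely_integrable_on {0..T}" "0 \<le> s" "t \<le> T"
    for q :: "real \<Rightarrow> 'd::euclidean_space" and s t
    using set_integrable_subset[OF that(1), of "{s..t}"] that set_lebesgue_integral_eq_integral(1) by auto
  define m where "m t = integral {0..t} e" for t
  have m_diff: "m t - m s = integral {s..t} e" if "0 \<le> s" "s \<le> t" "t \<le> T" for s t
    using Henstock_Kurzweil_Integration.integral_combine[of 0 s t e] sub[OF e, of 0 t] that
    by (simp add: m_def)
  have m_mono: "m s \<le> m t" if "0 \<le> s" "s \<le> t" "t \<le> T" for s t
  proof -
    have "0 \<le> integral {s..t} e"
      by (intro Henstock_Kurzweil_Integration.integral_nonneg sub[OF e] that) (simp add: e_def)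
    then show ?thesis using m_diff[OF that] by simp
  qed
  have incF: "norm (P t - P s) \<le> m t - m s"
    if P: "antiderivative_on T P p" and le: "\<And>r. norm (p r) \<le> e r" and st: "0 \<le> s" "s \<le> t" "t \<le> T"
    for P p :: "real \<Rightarrow> 'd::euclidean_space" and s t
    unfolding antiderivative_on_diff[OF P st] m_diff[OF st]
    by (intro integral_norm_bound_integral sub[OF e] sub le st) (use P in \<open>auto intro: antiderivative_on_integrable\<close>)
  define H where "H t = prod (F t) (G t) - integral {0..t} k" for t
  have H_incr: "norm (H t - H s) \<le> C * (m t - m s)\<^sup>2" if st: "0 \<le> s" "s \<le> t" "t \<le> T" for s t
  proof -
    have f': "f absolutely_integrable_on {s..t}" and g': "g absolutely_integrable_on {s..t}"
      using antiderivative_on_integrable[OF F] antiderivative_on_integrable[OF G] st by auto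
    have fi: "f integrable_on {s..t}" and gi: "g integrable_on {s..t}"
      using f' g' set_lebesgue_integral_eq_integral(1) by auto
    have cF: "continuous_on {s..t} F" and cG: "continuous_on {s..t} G"
      using contF contG st by (auto intro: continuous_on_subset)
    \<comment> \<open>Adding \<open>d\<close> to \<open>k\<close> freezes \<open>F\<close> at the
      right end and \<open>G\<close> at the left end. The integral of the sum is F t (G t - G s) +
      (F t - F s) G s, exactly the increment of the product, so the increment of \<open>H\<close> is
      the integral of \<open>d\<close>; both factors in \<open>d\<close> that are differences are at
      most m t - m s.\<close>
    define d where "d r = prod (F t - F r) (g r) + prod (f r) (G s - G r)" for r
    have d_abs: "d absolutely_integrable_on {s..t}"
      unfolding d_def using cF cG f' g' by (intro set_integral_add abs1 abs2 continuous_intros)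
    have kd: "k r + d r = prod (F t) (g r) + prod (f r) (G s)" for r
      by (simp add: k_def d_def diff_left diff_right)
    have i1: "((\<lambda>r. prod (F t) (g r)) has_integral prod (F t) (integral {s..t} g)) {s..t}"
      using has_integral_linear[OF integrable_integral[OF gi] bounded_linear_right[of "F t"]] by (simp add: o_def)
    have i2: "((\<lambda>r. prod (f r) (G s)) has_integral prod (integral {s..t} f) (G s)) {s..t}"
      using has_integral_linear[OF integrable_integral[OF fi] bounded_linear_left[of "G s"]] by (simp add: o_def)
    have "integral {s..t} k + integral {s..t} d = integral {s..t} (\<lambda>r. k r + d r)"
      using sub[OF k, of s t] d_abs st set_lebesgue_integral_eq_integral(1)
      by (intro Henstock_Kurzweil_Integration.integral_add[symmetric]) auto
    also have "\<dots> = prod (F t) (integral {s..t} g) + prod (integral {s..t} f) (G s)"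
      unfolding kd by (rule integral_unique[OF has_integral_add[OF i1 i2]])
    also have "\<dots> = prod (F t) (G t) - prod (F s) (G s)"
      unfolding antiderivative_on_diff[OF F st, symmetric] antiderivative_on_diff[OF G st, symmetric]
      by (simp add: diff_left diff_right)
    finally have "prod (F t) (G t) - prod (F s) (G s) - integral {s..t} k = integral {s..t} d" by (metis add_diff_cancel_left')
    moreover have "integral {0..t} k = integral {0..s} k + integral {s..t} k"
      using Henstock_Kurzweil_Integration.integral_combine[of 0 s t k] sub[OF k, of 0 t] st by simp
    ultimately have "H t - H s = integral {s..t} d" by (simp add: H_def algebra_simps)
    moreover have "norm (integral {s..t} d) \<le> integral {s..t} (\<lambda>r. C * (m t - m s) * e r)"
    proof (rule integral_norm_bound_integral)
      show "d integrable_on {s..t}" using d_abs set_lebesgue_integral_eq_integral(1) by auto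
      show "(\<lambda>r. C * (m t - m s) * e r) integrable_on {s..t}"
        using integrable_on_cmult_left[OF sub[OF e, of s t], of "C * (m t - m s)"] st by simp
      fix r assume r: "r \<in> {s..t}"
      have "norm (F t - F r) \<le> m t - m r"
        using r st by (intro incF[OF F]) (auto simp: e_def)
      also have "\<dots> \<le> m t - m s" using r st m_mono[of s r] by simp
      finally have 1: "norm (F t - F r) \<le> m t - m s" .
      have "norm (G s - G r) \<le> m r - m s"
        using r st by (subst norm_minus_commute, intro incF[OF G]) (auto simp: e_def)
      also have "\<dots> \<le> m t - m s" using r st m_mono[of r t] by simp
      finally have 2: "norm (G s - G r) \<le> m t - m s" .
      have "norm (d r) \<le> norm (F t - F r) * norm (g r) * C + norm (f r) * norm (G s - G r) * C"
        unfolding d_def by (rule order_trans[OF norm_triangle_ineq add_mono]) (rule C)+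
      also have "\<dots> \<le> (m t - m s) * norm (g r) * C + norm (f r) * (m t - m s) * C"
        using 1 2 C(1) by (intro add_mono mult_right_mono mult_left_mono) auto
      finally show "norm (d r) \<le> C * (m t - m s) * e r" by (simp add: e_def algebra_simps)
    qed
    moreover have "integral {s..t} (\<lambda>r. C * (m t - m s) * e r) = C * (m t - m s)\<^sup>2"
      using m_diff[OF st] by (simp add: power2_eq_square)
    ultimately show ?thesis by metis
  qed
  have "H t = H 0" if "t \<in> {0..T}" for t
  proof (rule eq_endpoints_if_square_increment[where m = m])
    show "continuous_on {0..t} m"
      unfolding m_def using that by (intro indefinite_integral_continuous_1 sub[OF e]) auto
    show "m r \<le> m s" if "0 \<le> r" "r \<le> s" "s \<le> t" for r s
      using m_mono that \<open>t \<in> {0..T}\<close> by simp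
    show "norm (H s - H r) \<le> C * (m s - m r)\<^sup>2" if "0 \<le> r" "r \<le> s" "s \<le> t" for r s
      using H_incr that \<open>t \<in> {0..T}\<close> by simp
  qed (use that in auto)
  then have "prod (F t) (G t) = prod (F 0) (G 0) + integral {0..t} k" if "t \<in> {0..T}" for t
    using that[THEN \<open>\<And>t. t \<in> {0..T} \<Longrightarrow> H t = H 0\<close>] by (simp only: H_def integral_refl) (simp add: algebra_simps)
  then show ?thesis
    using k unfolding antiderivative_on_def k_def[abs_def] by blast
qed

section \<open>Completion of squares\<close>

declare transpose_matrix_vector [simp del] vector_transpose_matrix [simp del]

text \<open>A product rule that needs \<open>W\<close> to be continuous only, because the first factor vanishes at \<open>t\<close>.\<close>

lemma bilinear_vanishing_has_vector_derivative:
  fixes prod :: "'a::real_normed_vector \<Rightarrow> 'b::real_normed_vector \<Rightarrow> 'c::real_normed_vector"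
  assumes bil: "bounded_bilinear prod"
    and h: "(h has_vector_derivative h') (at t within T)" "h t = 0"
    and W: "(W \<longlongrightarrow> W t) (at t within T)"
  shows "((\<lambda>s. prod (h s) (W s)) has_vector_derivative prod h' (W t)) (at t within T)"
proof -
  interpret bounded_bilinear prod by fact
  \<comment> \<open>\<open>k\<close> is the remainder of the first-order expansion of
    \<open>h\<close>, divided by the distance to \<open>t\<close>. It tends to 0, and
    \<open>W\<close> converges, so their product tends to 0.\<close>
  define k where "k s = (h s - h t - (s - t) *\<^sub>R h') /\<^sub>R norm (s - t)" for s
  have "(k \<longlongrightarrow> 0) (at t within T)"
    using h(1) unfolding has_vector_derivative_def has_derivative_at_within k_def by blast
  then have 1: "((\<lambda>s. prod (k s) (W s)) \<longlongrightarrow> prod 0 (W t)) (at t within T)"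
    by (rule tendsto[OF _ W])
  have "((\<lambda>s. prod h' (W s - W t)) \<longlongrightarrow> prod h' (W t - W t)) (at t within T)"
    by (intro tendsto tendsto_intros W)
  then have "((\<lambda>s. norm (prod h' (W s - W t))) \<longlongrightarrow> 0) (at t within T)"
    using tendsto_norm_zero by (simp add: zero_right)
  then have 2: "((\<lambda>s. ((s - t) / norm (s - t)) *\<^sub>R prod h' (W s - W t)) \<longlongrightarrow> 0) (at t within T)"
    by (rule Lim_null_comparison[rotated]) (auto simp: eventually_at_filter)
  have "((\<lambda>s. (prod (h s) (W s) - prod (h t) (W t) - (s - t) *\<^sub>R prod h' (W t)) /\<^sub>R norm (s - t)) \<longlongrightarrow> 0) (at t within T)"
  proof (rule Lim_transform_eventually)
    show "((\<lambda>s. prod (k s) (W s) + ((s - t) / norm (s - t)) *\<^sub>R prod h' (W s - W t)) \<longlongrightarrow> 0) (at t within T)"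
      using tendsto_add[OF 1 2] by (simp add: zero_left)
    show "\<forall>\<^sub>F s in at t within T. prod (k s) (W s) + ((s - t) / norm (s - t)) *\<^sub>R prod h' (W s - W t)
        = (prod (h s) (W s) - prod (h t) (W t) - (s - t) *\<^sub>R prod h' (W t)) /\<^sub>R norm (s - t)"
      by (rule always_eventually)
         (simp add: k_def h(2) zero_left diff_left diff_right scaleR_left scaleR_diff_right divide_inverse mult.commute)
  qed
  then show ?thesis
    unfolding has_vector_derivative_def has_derivative_at_within by (simp add: bounded_linear_scaleR_left)
qed

lemma matrix_inv_both:
  assumes "invertible M"
  shows "M ** matrix_inv M = mat 1" "matrix_inv M ** M = mat 1"
  using someI_ex[OF assms[unfolded invertible_def]] by (auto simp: matrix_inv_def)

text \<open>With W and W0 the inverses of U and U0, W - W0 = W (U0 - U) W0 gives |W - W0| \<le> |W|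
  e with e tending to 0. As soon as e < 1/2, this self-referential bound yields |W| \<le> 2 |W0|,
  and hence convergence.\<close>

lemma matrix_inv_tendsto:
  fixes U :: "'x \<Rightarrow> real^'a^'a"
  assumes U: "(U \<longlongrightarrow> U0) F" and inv: "\<forall>\<^sub>F s in F. invertible (U s)" and inv0: "invertible U0"
  shows "((\<lambda>s. matrix_inv (U s)) \<longlongrightarrow> matrix_inv U0) F"
proof -
  let ?W0 = "matrix_inv U0"
  obtain C where C: "0 \<le> C" "\<And>(x::real^'a^'a) (y::real^'a^'a). norm (x ** y) \<le> norm x * norm y * C"
    using mm.nonneg_bounded by blast
  define e where "e s = norm (U0 - U s) * norm ?W0 * C * C" for s
  have "((\<lambda>s. U0 - U s) \<longlongrightarrow> U0 - U0) F" by (intro tendsto_intros U)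
  then have "((\<lambda>s. norm (U0 - U s)) \<longlongrightarrow> 0) F" using tendsto_norm_zero by auto
  then have e: "(e \<longlongrightarrow> 0) F" unfolding e_def by (auto intro!: tendsto_mult_left_zero)
  have diff: "norm (matrix_inv (U s) - ?W0) \<le> norm (matrix_inv (U s)) * e s" if "invertible (U s)" for s
  proof -
    have "matrix_inv (U s) - ?W0 = matrix_inv (U s) ** (U0 - U s) ** ?W0"
      using matrix_inv_both[OF inv0] matrix_inv_both[OF that]
      by (simp add: mm.diff_left mm.diff_right flip: matrix_mul_assoc)
    also have "norm \<dots> \<le> (norm (matrix_inv (U s)) * norm (U0 - U s) * C) * norm ?W0 * C"
      by (rule order_trans[OF C(2)]) (intro mult_right_mono C, auto intro: C)
    finally show ?thesis by (simp add: e_def ac_simps)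
  qed
  have "\<forall>\<^sub>F s in F. norm (matrix_inv (U s) - ?W0) \<le> 2 * norm ?W0 * e s"
    using inv order_tendstoD(2)[OF e, of "1 / 2", simplified]
  proof eventually_elim
    case (elim s)
    have e0: "0 \<le> e s" using C(1) by (simp add: e_def)
    have "norm (matrix_inv (U s)) \<le> norm ?W0 + norm (matrix_inv (U s) - ?W0)" by norm
    also have "\<dots> \<le> norm ?W0 + norm (matrix_inv (U s)) * (1 / 2)"
      using diff[OF elim(1)] mult_left_mono[of "e s" "1 / 2" "norm (matrix_inv (U s))"] elim(2) by fastforce
    finally have "norm (matrix_inv (U s)) \<le> 2 * norm ?W0" by simp
    then show ?case using diff[OF elim(1)] mult_right_mono[OF _ e0] by (meson order_trans)
  qed
  moreover have "((\<lambda>s. 2 * norm ?W0 * e s) \<longlongrightarrow> 0) F" using e by (intro tendsto_mult_right_zero)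
  ultimately have "((\<lambda>s. matrix_inv (U s) - ?W0) \<longlongrightarrow> 0) F" by (rule Lim_null_comparison)
  then show ?thesis by (simp add: LIM_zero_iff)
qed

text \<open>Variation of constants. \<open>\<Psi>\<close> solves the adjoint equation, so that
  \<open>\<Psi> t ** \<Phi> t\<close> has derivative 0 and \<open>\<Psi>\<close> is the inverse of
  the fundamental matrix \<open>\<Phi>\<close>.\<close>

lemma forced_linear_ode_ex:
  fixes K :: "real^'a^'a" and h :: "real \<Rightarrow> real^'a"
  assumes "\<And>T. 0 \<le> T \<Longrightarrow> continuous_on {0..T} h"
  shows "\<exists>y. y 0 = y0 \<and> (\<forall>T\<ge>0. \<forall>t\<in>{0..T}. (y has_vector_derivative K *v y t + h t) (at t within {0..T}))"
proof -
  obtain \<Phi> :: "real \<Rightarrow> real^'a^'a"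
    where \<Phi>: "\<Phi> 0 = mat 1" "\<And>t. (\<Phi> has_vector_derivative K ** \<Phi> t) (at t)"
    using linear_ode_ex[OF mm.bounded_linear_right[of K]] by blast
  obtain \<Psi> :: "real \<Rightarrow> real^'a^'a"
    where \<Psi>: "\<Psi> 0 = mat 1" "\<And>t. (\<Psi> has_vector_derivative - \<Psi> t ** K) (at t)"
    using linear_ode_ex[OF bounded_linear_minus[OF mm.bounded_linear_left[of K]]] mm.minus_left by metis
  have "\<Psi> t ** \<Phi> t = mat 1" for t
  proof -
    have "((\<lambda>t. \<Psi> t ** \<Phi> t) has_vector_derivative 0) (at t)" for t
      using mm.has_vector_derivative[OF \<Psi>(2) \<Phi>(2), of t] by (simp add: matrix_algebra)
    then obtain c where "\<And>t. \<Psi> t ** \<Phi> t = c"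
      using has_vector_derivative_zero_constant[of UNIV "\<lambda>t. \<Psi> t ** \<Phi> t"] by auto
    then show ?thesis by (metis \<Phi>(1) \<Psi>(1) matrix_mul_lid)
  qed
  then have inv: "\<Phi> t ** \<Psi> t = mat 1" for t using matrix_left_right_inverse by blast
  define y where "y t = \<Phi> t *v (y0 + integral {0..t} (\<lambda>s. \<Psi> s *v h s))" for t
  have "(y has_vector_derivative K *v y t + h t) (at t within {0..T})" if "0 \<le> T" "t \<in> {0..T}" for t T
  proof -
    have "continuous_on {0..T} \<Psi>"
      using \<Psi>(2) by (meson continuous_at_imp_continuous_on has_vector_derivative_continuous)
    then have "continuous_on {0..T} (\<lambda>s. \<Psi> s *v h s)"
      using assms \<open>0 \<le> T\<close> by (intro mv.continuous_on) auto
    then have "((\<lambda>t. integral {0..t} (\<lambda>s. \<Psi> s *v h s)) has_vector_derivative \<Psi> t *v h t) (at t within {0..T})"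
      using integral_has_vector_derivative that by fast
    then have "((\<lambda>t. y0 + integral {0..t} (\<lambda>s. \<Psi> s *v h s)) has_vector_derivative 0 + \<Psi> t *v h t) (at t within {0..T})"
      by (intro has_vector_derivative_add has_vector_derivative_const)
    from mv.has_vector_derivative[OF has_vector_derivative_at_within[OF \<Phi>(2)] this]
    show ?thesis by (simp add: y_def[abs_def] matrix_vector_mul_assoc inv add.commute)
  qed
  moreover have "y 0 = y0" by (simp add: y_def \<Phi>)
  ultimately show ?thesis by blast
qed

lemma sum_UNIV_sum_type:
  "sum g (UNIV :: ('a::finite + 'b::finite) set) = (\<Sum>a\<in>UNIV. g (Inl a)) + (\<Sum>b\<in>UNIV. g (Inr b))"
  using sum.Plus[of "UNIV :: 'a set" "UNIV :: 'b set" g] by simp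

lemma block_vec_inner: "block_vec x u \<bullet> block_vec y v = x \<bullet> y + u \<bullet> v"
  by (simp add: inner_vec_def block_vec_def sum_UNIV_sum_type)

lemma block_mat_mult_block_vec:
  "block_mat M11 M12 M21 M22 *v block_vec x u = block_vec (M11 *v x + M12 *v u) (M21 *v x + M22 *v u)"
  by (simp add: vec_eq_iff matrix_vector_mult_def block_mat_def block_vec_def sum_UNIV_sum_type
      split: sum.split)

section \<open>Algebra of the Riccati operator for a singular weight \<open>R\<close>\<close>

locale lq =
  fixes A Q :: "real^'n^'n" and B S :: "real^'m^'n" and R :: "real^'m^'m"
  assumes psd_popov: "psd (popov Q S R)"
begin

text \<open>The running cost, that is, the integrand of \<open>J_infty\<close>.\<close>

definition ell :: "real^'n \<Rightarrow> real^'m \<Rightarrow> real" where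
  "ell x u = block_vec x u \<bullet> (popov Q S R *v block_vec x u)"

lemma ell_eq: "ell x u = x \<bullet> (Q *v x) + 2 * (x \<bullet> (S *v u)) + u \<bullet> (R *v u)"
  using inner_transpose_left[of S x u]
  by (simp add: ell_def popov_def block_mat_mult_block_vec block_vec_inner inner_add_right inner_commute)

lemma ell_nonneg: "0 \<le> ell x u"
  using psd_popov by (simp add: ell_def psd_def)

lemma transpose_Q: "transpose Q = Q" and transpose_R: "transpose R = R"
proof -
  have *: "popov Q S R $ i $ j = popov Q S R $ j $ i" for i j
  proof -
    have "transpose (popov Q S R) $ j $ i = popov Q S R $ j $ i" using psd_popov by (simp add: psd_def)
    then show ?thesis by (simp add: transpose_def)
  qed
  have "Q $ j $ i = Q $ i $ j" for i j
    using *[of "Inl j" "Inl i"] by (simp add: popov_def block_mat_def)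
  then show "transpose Q = Q" by (simp add: transpose_def vec_eq_iff)
  have "R $ j $ i = R $ i $ j" for i j
    using *[of "Inr j" "Inr i"] by (simp add: popov_def block_mat_def)
  then show "transpose R = R" by (simp add: transpose_def vec_eq_iff)
qed

lemma psd_R: "psd R"
  using ell_nonneg[of 0] by (simp add: psd_def transpose_R ell_eq)

abbreviation "P \<equiv> pinv R"

lemma R_P_R: "R *v (P *v (R *v v)) = R *v v"
  using is_pinv_pinv_symmetric[OF transpose_R]
  by (auto simp: is_pinv_def matrix_vector_mul_assoc matrix_mul_assoc)

lemma transpose_P: "transpose P = P"
  by (rule transpose_pinv_symmetric[OF transpose_R])

text \<open>\<open>mat 1 - P ** R\<close> projects onto ker R, so the inclusion says that M
  annihilates its range, i.e. M P R = M.\<close>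

lemma mat_ker_R_iff: "mat_ker R \<subseteq> mat_ker M \<longleftrightarrow> (\<forall>v. M *v (P *v (R *v v)) = M *v v)"
proof
  assume "mat_ker R \<subseteq> mat_ker M"
  moreover have "v - P *v (R *v v) \<in> mat_ker R" for v
    by (simp add: mat_ker_def mv.diff_right R_P_R)
  ultimately have "M *v (v - P *v (R *v v)) = 0" for v by (auto simp: mat_ker_def)
  then show "\<forall>v. M *v (P *v (R *v v)) = M *v v" by (simp add: mv.diff_right)
qed (auto simp: mat_ker_def, metis mv.zero_right)

text \<open>This is the transpose of M P R = M, both R and P being symmetric: the range of the
  transpose of M lies in the range of R, on which R P is the identity.\<close>

lemma R_P_transpose:
  assumes "mat_ker R \<subseteq> mat_ker M"
  shows "R *v (P *v (transpose M *v x)) = transpose M *v x"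
proof -
  have "y \<bullet> (R *v (P *v (transpose M *v x))) = y \<bullet> (transpose M *v x)" for y
  proof -
    have "y \<bullet> (R *v (P *v (transpose M *v x))) = x \<bullet> (M *v (P *v (R *v y)))"
      by (metis inner_commute inner_symmetric_swap inner_transpose_left transpose_P transpose_R)
    also have "\<dots> = x \<bullet> (M *v y)" using assms[unfolded mat_ker_R_iff] by simp
    finally show ?thesis by (metis inner_commute inner_transpose_left)
  qed
  then show ?thesis by (metis vector_eq_ldot)
qed

text \<open>For v in ker R the nonnegative cost \<open>ell x (c v)\<close> is affine in c with slope
  2 x . S v, so this slope vanishes.\<close>

lemma mat_ker_R_S: "mat_ker R \<subseteq> mat_ker S"
proof
  fix v assume "v \<in> mat_ker R"
  then have v: "R *v v = 0" by (simp add: mat_ker_def)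
  have "x \<bullet> (S *v v) = 0" for x
  proof -
    have "0 \<le> x \<bullet> (Q *v x) + c * (2 * (x \<bullet> (S *v v)))" for c
      using ell_nonneg[of x "c *\<^sub>R v"] by (simp add: ell_eq mv.scaleR_right v algebra_simps)
    then show ?thesis using affine_nonneg_imp_zero by fastforce
  qed
  then show "v \<in> mat_ker S" by (metis (mono_tags) inner_zero_right mat_ker_def mem_Collect_eq vector_eq_ldot)
qed

abbreviation "ric \<equiv> riccati_op A B Q S R"

text \<open>The feedback u = - \<open>gain X\<close> x is the centre of the completed
  square.\<close>

definition "gain X = P ** (transpose S + transpose B ** X)"

lemma transpose_S_plus:
  assumes "transpose X = X"
  shows "transpose (S + X ** B) = transpose S + transpose B ** X"
  by (simp add: transpose_add matrix_transpose_mul assms)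

text \<open>The left-hand side is the running cost plus the rate of change of x . X x along x' = A x
  + B u with X held constant. All terms mixing u and x combine into 2 l . u with l = (S + X B)^T x,
  and the kernel condition gives R P l = l, so the square centred at -P l has this very cross
  term.\<close>

lemma completion_of_squares:
  assumes X: "transpose X = X" and ker: "mat_ker R \<subseteq> mat_ker (S + X ** B)"
  shows "ell x u + 2 * (x \<bullet> (X *v (A *v x + B *v u)))
       = x \<bullet> (ric X *v x) + (u + gain X *v x) \<bullet> (R *v (u + gain X *v x))"
proof -
  define l where "l = transpose (S + X ** B) *v x"
  have l: "l = transpose S *v x + transpose B *v (X *v x)"
    unfolding l_def by (simp add: transpose_S_plus X mv.add_left matrix_vector_mul_assoc)
  have RPl: "R *v (P *v l) = l" unfolding l_def by (rule R_P_transpose[OF ker])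
  have lS: "((S + X ** B) *v (P *v l)) \<bullet> x = l \<bullet> (P *v l)"
    by (metis inner_commute inner_transpose_left l_def)
  have "gain X *v x = P *v l"
    by (simp add: gain_def l matrix_algebra)
  moreover have "(u + P *v l) \<bullet> (R *v (u + P *v l)) = u \<bullet> (R *v u) + 2 * (l \<bullet> u) + l \<bullet> (P *v l)"
    using inner_symmetric_swap[OF transpose_R, of "P *v l" u]
    by (simp add: mv.add_right RPl inner_add_left inner_add_right inner_commute)
  moreover have "l \<bullet> u = x \<bullet> (S *v u) + x \<bullet> (X *v (B *v u))"
    by (simp add: l_def inner_transpose_left mv.add_left inner_add_right matrix_vector_mul_assoc)
  moreover have "x \<bullet> (ric X *v x) = 2 * (x \<bullet> (X *v (A *v x))) - l \<bullet> (P *v l) + x \<bullet> (Q *v x)"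
  proof -
    have "ric X *v x = X *v (A *v x) + transpose A *v (X *v x) - (S + X ** B) *v (P *v l) + Q *v x"
      by (simp add: riccati_op_def l matrix_algebra)
    moreover have "x \<bullet> (transpose A *v (X *v x)) = x \<bullet> (X *v (A *v x))"
      by (metis inner_commute inner_transpose_left inner_symmetric_swap X)
    ultimately show ?thesis using lS by (simp add: inner_add_right inner_diff_right inner_commute)
  qed
  ultimately show ?thesis by (simp add: ell_eq mv.add_right inner_add_right)
qed

text \<open>The preliminary feedback u = - P S^T x removes the cross weight \<open>S\<close>:
  \<open>A0\<close> is the closed-loop matrix, and \<open>Q0\<close> is the generalised Schur
  complement of \<open>R\<close> in the Popov matrix.\<close>

definition "A0 = A - B ** P ** transpose S"
definition "N = B ** P ** transpose B"
definition "Q0 = Q - S ** P ** transpose S"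

lemma ric_eq: "ric X = X ** A0 + transpose A0 ** X - X ** N ** X + Q0"
  by (simp add: riccati_op_def A0_def N_def Q0_def transpose_diff matrix_transpose_mul transpose_P matrix_algebra)

lemma psd_N: "psd N"
proof -
  have "x \<bullet> (N *v x) = (transpose B *v x) \<bullet> (P *v (transpose B *v x))" for x
    by (simp add: N_def inner_transpose_left matrix_vector_mul_assoc matrix_mul_assoc)
  then show ?thesis
    using psd_pinv[OF psd_R] by (simp add: psd_def N_def matrix_transpose_mul transpose_P matrix_mul_assoc)
qed

text \<open>Since \<open>ric 0 = Q0\<close>, completing the square with X = 0 identifies x . Q0 x as
  the running cost at u = - \<open>gain 0\<close> x, which is nonnegative.\<close>

lemma psd_Q0: "psd Q0"
proof -
  have "x \<bullet> (Q0 *v x) = ell x (- (gain 0 *v x))" for x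
  proof -
    have "ric 0 = Q0" unfolding ric_eq by (simp only: mm.zero_left mm.zero_right) simp
    then show ?thesis
      using completion_of_squares[of 0 x "- (gain 0 *v x)"] mat_ker_R_S
      by (simp add: transpose_zero)
  qed
  then have "0 \<le> x \<bullet> (Q0 *v x)" for x by (simp add: ell_nonneg)
  then show ?thesis
    by (simp add: psd_def Q0_def transpose_diff matrix_transpose_mul transpose_P transpose_Q matrix_mul_assoc)
qed

lemma transpose_N: "transpose N = N" and transpose_Q0: "transpose Q0 = Q0"
  using psd_N psd_Q0 by (auto simp: psd_def)

end

section \<open>The Riccati flow\<close>

text \<open>Gronwall with coefficients bounded on the compact interval. The two-sided form f K + M f
  is the one that arises from differences and right multiples of Riccati solutions.\<close>

lemma matrix_linear_ode_zero:
  fixes f K M :: "real \<Rightarrow> real^'a^'a"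
  assumes der: "\<And>t. t \<in> {0..T} \<Longrightarrow> (f has_vector_derivative f t ** K t + M t ** f t) (at t within {0..T})"
    and cont: "continuous_on {0..T} K" "continuous_on {0..T} M"
    and "f 0 = 0" "t \<in> {0..T}"
  shows "f t = 0"
proof -
  obtain C where C: "0 \<le> C" "\<And>(x::real^'a^'a) (y::real^'a^'a). norm (x ** y) \<le> norm x * norm y * C"
    using mm.nonneg_bounded by blast
  have bdd: "\<exists>k. \<forall>t\<in>{0..T}. norm (L t) \<le> k" if "continuous_on {0..T} L" for L :: "real \<Rightarrow> real^'a^'a"
    using compact_imp_bounded[OF compact_continuous_image[OF that]] by (auto simp: bounded_iff)
  obtain k m where km: "\<And>t. t \<in> {0..T} \<Longrightarrow> norm (K t) \<le> k" "\<And>t. t \<in> {0..T} \<Longrightarrow> norm (M t) \<le> m"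
    using bdd[OF cont(1)] bdd[OF cont(2)] by blast
  show ?thesis
  proof (rule gronwall_zero[where L = "(k + m) * C", OF der _ assms(4,5)])
    fix t assume t: "t \<in> {0..T}"
    have "norm (f t ** K t + M t ** f t) \<le> norm (f t) * norm (K t) * C + norm (M t) * norm (f t) * C"
      by (rule order_trans[OF norm_triangle_ineq add_mono]) (rule C)+
    also have "\<dots> \<le> norm (f t) * k * C + m * norm (f t) * C"
      using km t C(1) by (intro add_mono mult_right_mono mult_left_mono) auto
    finally show "norm (f t ** K t + M t ** f t) \<le> (k + m) * C * norm (f t)"
      by (simp add: algebra_simps)
  qed
qed

lemma mono_bounded_tendsto_at_top:
  fixes f :: "real \<Rightarrow> real"
  assumes mono: "\<And>s t. 0 \<le> s \<Longrightarrow> s \<le> t \<Longrightarrow> f s \<le> f t" and bdd: "\<And>t. 0 \<le> t \<Longrightarrow> f t \<le> c"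
  obtains l where "(f \<longlongrightarrow> l) at_top" "\<And>t. 0 \<le> t \<Longrightarrow> f t \<le> l"
proof -
  define l where "l = (SUP t\<in>{0..}. f t)"
  have bdd': "bdd_above (f ` {0..})" using bdd by (auto intro!: bdd_aboveI2[where M = c])
  have le: "f t \<le> l" if "0 \<le> t" for t unfolding l_def using that bdd' by (intro cSUP_upper) auto
  have "(f \<longlongrightarrow> l) at_top"
  proof (rule increasing_tendsto)
    show "\<forall>\<^sub>F t in at_top. f t \<le> l" using eventually_ge_at_top[of 0] by eventually_elim (rule le)
    fix x assume "x < l"
    then obtain s where s: "0 \<le> s" "x < f s" unfolding l_def using bdd' by (subst (asm) less_cSUP_iff) auto
    show "\<forall>\<^sub>F t in at_top. x < f t"
      using eventually_ge_at_top[of s] by eventually_elim (use s mono in force)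
  qed
  then show ?thesis using le that by blast
qed

text \<open>By the mean value theorem the increment of \<open>g\<close> over [a, a + 1], which tends
  to 0, is a value of \<open>g'\<close> close to \<open>c\<close>.\<close>

lemma limit_derivative_zero:
  fixes g :: "real \<Rightarrow> real"
  assumes der: "\<And>t. 0 \<le> t \<Longrightarrow> (g has_real_derivative g' t) (at t within {0..})"
    and lim: "(g \<longlongrightarrow> l) at_top" "(g' \<longlongrightarrow> c) at_top"
  shows "c = 0"
proof -
  have "\<bar>c\<bar> \<le> e" if "e > 0" for e
  proof -
    \<comment> \<open>Three errors of size e / 3 add up: one for \<open>g'\<close> at the
      intermediate point and one for \<open>g\<close> at each end point.\<close>
    have "\<forall>\<^sub>F t in at_top. \<bar>g' t - c\<bar> < e / 3 \<and> \<bar>g t - l\<bar> < e / 3"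
      using tendstoD[OF lim(2), of "e / 3"] tendstoD[OF lim(1), of "e / 3"] that
      by (auto simp: dist_real_def elim: eventually_elim2)
    then obtain T where T: "\<And>t. t \<ge> T \<Longrightarrow> \<bar>g' t - c\<bar> < e / 3 \<and> \<bar>g t - l\<bar> < e / 3"
      by (auto simp: eventually_at_top_linorder)
    define a where "a = max T 0"
    have "\<exists>s\<in>{a..a + 1}. g (a + 1) - g a = (*) (g' s) (a + 1 - a)"
    proof (rule mvt_very_simple)
      fix x assume "a \<le> x" "x \<le> a + 1"
      then show "(g has_derivative (*) (g' x)) (at x within {a..a + 1})"
        using der[of x] by (auto simp: has_field_derivative_def a_def intro: has_derivative_subset)
    qed simp
    then obtain s where "s \<ge> a" "g (a + 1) - g a = g' s" by auto
    moreover have "T \<le> a" by (simp add: a_def)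
    ultimately show ?thesis using T[of s] T[of a] T[of "a + 1"] by linarith
  qed
  then have "\<bar>c\<bar> \<le> 0" by (rule field_le_epsilon) simp
  then show ?thesis by simp
qed

section \<open>Uniqueness, global existence, sign and kernel of the Riccati flow\<close>

context lq begin

lemma riccati_flow_derivative:
  assumes X: "riccati_flow A B Q S R X" and s: "s \<in> {0..t}"
  shows "(X has_vector_derivative ric (X s)) (at s within {0..t})"
proof -
  have "(X has_vector_derivative ric (X s)) (at s within {0..})"
    using X s by (simp add: riccati_flow_def)
  then show ?thesis by (rule has_vector_derivative_within_subset) auto
qed

lemma riccati_flow_continuous:
  assumes X: "riccati_flow A B Q S R X"
  shows "continuous_on {0..t} X"
  unfolding continuous_on_eq_continuous_within
  using has_vector_derivative_continuous[OF riccati_flow_derivative[OF X]] by blast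

text \<open>With D = Y - X the quadratic terms split as Y N Y - X N X = D N Y + X N D, so D solves a
  linear equation with zero initial value.\<close>

lemma flow_unique:
  assumes X: "riccati_flow A B Q S R X" and Y: "riccati_flow A B Q S R Y" and t: "0 \<le> t"
  shows "Y t = X t"
proof -
  note dX = riccati_flow_derivative[OF X] and dY = riccati_flow_derivative[OF Y]
  have "Y t - X t = 0"
  proof (rule matrix_linear_ode_zero[where f = "\<lambda>t. Y t - X t" and T = t
        and K = "\<lambda>t. A0 - N ** Y t" and M = "\<lambda>t. transpose A0 - X t ** N"])
    have "ric (Y s) - ric (X s) = (Y s - X s) ** (A0 - N ** Y s) + (transpose A0 - X s ** N) ** (Y s - X s)" for s
      by (simp add: ric_eq matrix_algebra)
    then show "((\<lambda>t. Y t - X t) has_vector_derivative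
        (Y s - X s) ** (A0 - N ** Y s) + (transpose A0 - X s ** N) ** (Y s - X s)) (at s within {0..t})"
      if "s \<in> {0..t}" for s
      using has_vector_derivative_diff[OF dY dX, OF that that] by simp
    have "continuous_on {0..t} X" "continuous_on {0..t} Y"
      by (rule riccati_flow_continuous[OF X], rule riccati_flow_continuous[OF Y])
    then show "continuous_on {0..t} (\<lambda>t. A0 - N ** Y t)" "continuous_on {0..t} (\<lambda>t. transpose A0 - X t ** N)"
      by (auto intro!: continuous_intros mm.continuous_on)
    show "Y 0 - X 0 = 0" using X Y by (simp add: riccati_flow_def)
  qed (use t in auto)
  then show ?thesis by simp
qed

lemma transpose_ric: "transpose (ric X) = ric (transpose X)"
  by (simp add: ric_eq transpose_add transpose_diff matrix_transpose_mul transpose_N transpose_Q0 matrix_mul_assoc add.commute)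

text \<open>The transposed flow solves the same initial value problem, so uniqueness
  applies.\<close>

lemma flow_symmetric:
  assumes X: "riccati_flow A B Q S R X" and t: "0 \<le> t"
  shows "transpose (X t) = X t"
proof (rule flow_unique[OF X _ t])
  show "riccati_flow A B Q S R (\<lambda>t. transpose (X t))"
    using X bounded_linear.has_vector_derivative[OF bounded_linear_transpose]
    by (auto simp: riccati_flow_def transpose_zero simp flip: transpose_ric)
qed

text \<open>A quadratic equation could escape in finite time. The linear Hamiltonian system lives
  for all times, so the only possible obstruction is a singular \<open>U\<close>. The sign of
  \<open>ric (X t)\<close> is part of the statement because its proof uses the same \<open>U\<close>
  and \<open>V\<close>.\<close>

lemma flow_ex:
  "\<exists>X. riccati_flow A B Q S R X \<and> (\<forall>t\<ge>0. \<forall>x. 0 \<le> x \<bullet> (ric (X t) *v x))"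
proof -
  define F where "F p = (N ** snd p - A0 ** fst p, Q0 ** fst p + transpose A0 ** snd p)"
    for p :: "(real^'n^'n) \<times> (real^'n^'n)"
  have "bounded_linear F"
    unfolding F_def
    by (intro bounded_linear_Pair bounded_linear_sub bounded_linear_add
        bounded_linear_compose[OF mm.bounded_linear_right bounded_linear_fst]
        bounded_linear_compose[OF mm.bounded_linear_right bounded_linear_snd])
  from linear_ode_ex[OF this, of "(mat 1, 0)"] obtain y
    where y: "y 0 = (mat 1, 0)" "\<And>t. (y has_vector_derivative F (y t)) (at t)" by blast
  define U where "U t = fst (y t)" for t
  define V where "V t = snd (y t)" for t
  have UV0: "U 0 = mat 1" "V 0 = 0" by (simp_all add: U_def V_def y)
  have dU: "(U has_vector_derivative N ** V t - A0 ** U t) (at t)" for t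
    using bounded_linear.has_vector_derivative[OF bounded_linear_fst y(2)[of t]]
    by (simp add: U_def[abs_def] V_def F_def)
  have dV: "(V has_vector_derivative Q0 ** U t + transpose A0 ** V t) (at t)" for t
    using bounded_linear.has_vector_derivative[OF bounded_linear_snd y(2)[of t]]
    by (simp add: V_def[abs_def] U_def F_def)
  have dx: "((\<lambda>t. U t *v z) has_vector_derivative N *v (V t *v z) - A0 *v (U t *v z)) (at t)" for t z
    using bounded_linear.has_vector_derivative[OF mv.bounded_linear_left dU[of t], of z]
    by (simp add: mv.diff_left matrix_vector_mul_assoc)
  have dp: "((\<lambda>t. V t *v z) has_vector_derivative Q0 *v (U t *v z) + transpose A0 *v (V t *v z)) (at t)" for t z
    using bounded_linear.has_vector_derivative[OF mv.bounded_linear_left dV[of t], of z]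
    by (simp add: mv.add_left matrix_vector_mul_assoc)
  have dphi: "((\<lambda>t. (U t *v z) \<bullet> (V t *v z)) has_real_derivative
      (U t *v z) \<bullet> (Q0 *v (U t *v z)) + (V t *v z) \<bullet> (N *v (V t *v z))) (at t)" for t z
  proof -
    have "(U t *v z) \<bullet> (transpose A0 *v (V t *v z)) = (A0 *v (U t *v z)) \<bullet> (V t *v z)"
      by (metis inner_commute inner_transpose_left)
    then show ?thesis
      using bounded_bilinear.has_vector_derivative[OF bounded_bilinear_inner dx[of z t] dp[of z t]]
      by (simp add: has_real_derivative_iff_has_vector_derivative inner_add_right inner_diff_right inner_commute)
  qed
  have nonneg: "0 \<le> x \<bullet> (Q0 *v x)" "0 \<le> x \<bullet> (N *v x)" for x
    using psd_Q0 psd_N by (auto simp: psd_def)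
  have inv: "invertible (U T)" if T: "0 \<le> T" for T
  proof -
    have "z = 0" if z: "U T *v z = 0" for z
    \<comment> \<open>The case \<open>T = 0\<close> is split off because one-sided derivatives at
      the end points are unique only on a nondegenerate interval.\<close>
    proof (cases "T = 0")
      case True
      then show ?thesis using z UV0 by simp
    next
      case False
      define \<phi> where "\<phi> t = (U t *v z) \<bullet> (V t *v z)" for t
      have mono: "\<phi> s \<le> \<phi> t" if "s \<le> t" for s t
        unfolding \<phi>_def
        by (rule DERIV_nonneg_imp_nondecreasing[OF that]) (use dphi nonneg in \<open>blast intro: add_nonneg_nonneg\<close>)
      have "\<phi> 0 = 0" "\<phi> T = 0" by (simp_all add: \<phi>_def UV0 z)
      then have const: "\<phi> t = 0" if "t \<in> {0..T}" for t
        using mono[of 0 t] mono[of t T] that by simp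
      \<comment> \<open>\<open>\<phi>\<close> is identically 0 on [0, T], hence so is its
        derivative, a sum of two nonnegative terms; the term with \<open>N\<close> therefore
        vanishes.\<close>
      have zero: "N *v (V t *v z) = 0" if t: "t \<in> {0..T}" for t
      proof -
        have "(\<phi> has_vector_derivative (U t *v z) \<bullet> (Q0 *v (U t *v z)) + (V t *v z) \<bullet> (N *v (V t *v z)))
            (at t within cbox 0 T)"
          unfolding \<phi>_def has_real_derivative_iff_has_vector_derivative[symmetric]
          by (rule DERIV_subset[OF dphi]) simp
        moreover have "(\<phi> has_vector_derivative 0) (at t within cbox 0 T)"
          by (rule has_vector_derivative_transform[of _ _ _ "\<lambda>_. 0"]) (use const t in auto)
        ultimately have "(U t *v z) \<bullet> (Q0 *v (U t *v z)) + (V t *v z) \<bullet> (N *v (V t *v z)) = 0"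
          by (rule vector_derivative_unique_within_closed_interval[rotated 2]) (use t False T in auto)
        then have "(V t *v z) \<bullet> (N *v (V t *v z)) = 0"
          using nonneg by (simp add: add_nonneg_eq_0_iff)
        then show ?thesis using psd_quadratic_zero[OF psd_N] by simp
      qed
      obtain L where L: "\<And>x. norm (A0 *v x) \<le> norm x * L"
        using bounded_linear.bounded[OF mv.bounded_linear_right[of A0]] by blast
      \<comment> \<open>Without the \<open>N\<close> term, U z solves x' = - A0 x on [0, T] and ends
        in 0, so it also starts in 0; but it starts in z.\<close>
      have "(\<lambda>t. U t *v z) 0 = 0"
      proof (rule gronwall_zero_backwards[where L = L and a = 0 and b = T
            and f' = "\<lambda>t. N *v (V t *v z) - A0 *v (U t *v z)"])
        show "((\<lambda>t. U t *v z) has_vector_derivative N *v (V t *v z) - A0 *v (U t *v z)) (at t within {0..T})" for t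
          by (rule has_vector_derivative_at_within[OF dx])
        show "norm (N *v (V t *v z) - A0 *v (U t *v z)) \<le> L * norm (U t *v z)" if "t \<in> {0..T}" for t
          using zero[OF that] L by (simp add: mult.commute)
      qed (use z T in auto)
      then show ?thesis by (simp add: UV0)
    qed
    then show ?thesis
      using matrix_left_invertible_ker matrix_left_right_inverse unfolding invertible_def by metis
  qed
  define X where "X t = V t ** matrix_inv (U t)" for t
  have XU: "X t ** U t = V t" if "0 \<le> t" for t
    using matrix_inv_both[OF inv[OF that]] by (simp add: X_def flip: matrix_mul_assoc)
  have contW: "((\<lambda>s. matrix_inv (U s)) \<longlongrightarrow> matrix_inv (U t)) (at t within {0..})" if "0 \<le> t" for t
  proof (rule matrix_inv_tendsto)
    show "(U \<longlongrightarrow> U t) (at t within {0..})"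
      using has_vector_derivative_continuous[OF has_vector_derivative_at_within[OF dU]]
      by (simp add: continuous_within)
    show "\<forall>\<^sub>F s in at t within {0..}. invertible (U s)"
      using inv by (auto simp: eventually_at_filter)
  qed (rule inv[OF that])
  have dX: "(X has_vector_derivative ric (X t)) (at t within {0..})" if t: "0 \<le> t" for t
  proof -
    \<comment> \<open>X s = X t + h s (U s)^-1 with h t = 0, so the derivative at t needs only
      continuity of the inverse and not its derivative.\<close>
    define h where "h s = V s - X t ** U s" for s
    have dh: "(h has_vector_derivative
        (Q0 ** U t + transpose A0 ** V t) - X t ** (N ** V t - A0 ** U t)) (at t within {0..})"
      unfolding h_def
      by (intro has_vector_derivative_diff has_vector_derivative_at_within[OF dV]
          bounded_linear.has_vector_derivative[OF mm.bounded_linear_right]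
          has_vector_derivative_at_within[OF dU])
    have "h t = 0" by (simp add: h_def XU[OF t])
    note d = bilinear_vanishing_has_vector_derivative[OF bounded_bilinear_matrix_matrix_mult dh this contW[OF t]]
    have "((Q0 ** U t + transpose A0 ** V t) - X t ** (N ** V t - A0 ** U t)) ** matrix_inv (U t) = ric (X t)"
      using matrix_inv_both[OF inv[OF t]]
      by (simp add: ric_eq X_def mm.add_left mm.diff_left mm.diff_right flip: matrix_mul_assoc)
    then have "((\<lambda>s. X t + h s ** matrix_inv (U s)) has_vector_derivative ric (X t)) (at t within {0..})"
      using has_vector_derivative_add[OF has_vector_derivative_const d] by simp
    then show ?thesis
    proof (rule has_vector_derivative_transform[rotated 2])
      fix s :: real assume "s \<in> {0..}"
      then have "U s ** matrix_inv (U s) = mat 1" using matrix_inv_both(1)[OF inv] by simp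
      then show "X s = X t + h s ** matrix_inv (U s)"
        by (simp add: h_def X_def mm.diff_left flip: matrix_mul_assoc)
    qed (use t in simp)
  qed
  have flow: "riccati_flow A B Q S R X"
    using dX by (simp add: riccati_flow_def X_def UV0)
  have pos: "0 \<le> x \<bullet> (ric (X t) *v x)" if t: "0 \<le> t" for t x
  proof -
    define z where "z = matrix_inv (U t) *v x"
    have x: "x = U t *v z"
      using matrix_inv_both[OF inv[OF t]] by (simp add: z_def matrix_vector_mul_assoc)
    \<comment> \<open>The Hamiltonian along the solution through z. At time t it is x .
      \<open>ric (X t)\<close> x, because V z = X x there; at time 0 it is z . Q0 z, because V
      starts at 0.\<close>
    define H where "H t = 2 * ((V t *v z) \<bullet> (A0 *v (U t *v z))) - (V t *v z) \<bullet> (N *v (V t *v z))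
        + (U t *v z) \<bullet> (Q0 *v (U t *v z))" for t
    have "(H has_vector_derivative 0) (at t)" for t
    proof -
      let ?x = "U t *v z" and ?p = "V t *v z"
      let ?x' = "N *v ?p - A0 *v ?x" and ?p' = "Q0 *v ?x + transpose A0 *v ?p"
      note lin = bounded_linear.has_vector_derivative[OF mv.bounded_linear_right]
      note inn = bounded_bilinear.has_vector_derivative[OF bounded_bilinear_inner]
      have d: "(H has_vector_derivative (2 * (?p \<bullet> (A0 *v ?x') + ?p' \<bullet> (A0 *v ?x)))
          - (?p \<bullet> (N *v ?p') + ?p' \<bullet> (N *v ?p)) + (?x \<bullet> (Q0 *v ?x') + ?x' \<bullet> (Q0 *v ?x))) (at t)"
        unfolding H_def
        by (intro has_vector_derivative_add has_vector_derivative_diff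
            bounded_linear.has_vector_derivative[OF bounded_linear_mult_right] inn lin dx dp)
      have e: "?p \<bullet> (N *v ?p') = (N *v ?p) \<bullet> ?p'" "?x \<bullet> (Q0 *v ?x') = (Q0 *v ?x) \<bullet> ?x'"
        using inner_symmetric_swap transpose_N transpose_Q0 by metis+
      have e': "?p \<bullet> (A0 *v ?x') = (transpose A0 *v ?p) \<bullet> ?x'"
        by (rule inner_transpose_left[symmetric])
      show ?thesis
        using d unfolding e e' by (rule back_subst[where P = "\<lambda>D. (H has_vector_derivative D) (at t)"])
          (simp add: inner_add_left inner_add_right inner_diff_left inner_diff_right inner_commute algebra_simps)
    qed
    then obtain c where "\<And>t. H t = c"
      using has_vector_derivative_zero_constant[of UNIV H] by auto
    then have "H t = H 0" by simp
    also have "H 0 = z \<bullet> (Q0 *v z)" by (simp add: H_def UV0)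
    finally have "0 \<le> H t" using nonneg by simp
    moreover have "x \<bullet> (ric (X t) *v x) = H t"
    proof -
      have Xx: "X t *v x = V t *v z" by (simp add: x matrix_vector_mul_assoc XU[OF t])
      have sym: "x \<bullet> (X t *v w) = (V t *v z) \<bullet> w" for w
        using inner_symmetric_swap[OF flow_symmetric[OF flow t], of x w] by (simp add: Xx)
      have "x \<bullet> (transpose A0 *v (V t *v z)) = (V t *v z) \<bullet> (A0 *v x)"
        by (metis inner_commute inner_transpose_left)
      then show ?thesis
        by (simp add: ric_eq mv.add_left mv.diff_left inner_add_right inner_diff_right sym Xx H_def flip: matrix_vector_mul_assoc x)
    qed
    ultimately show ?thesis by simp
  qed
  show ?thesis using flow pos by blast
qed

text \<open>The kernel of a symmetric solution \<open>X0\<close> of CGCARE is \<open>A0\<close>-invariant and contained in \<open>ker Q0\<close>,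
  so that the flow, which starts at \<open>0\<close>, stays \<open>0\<close> on it.\<close>

lemma flow_ker:
  assumes X: "riccati_flow A B Q S R X" and t: "0 \<le> t"
    and X0: "transpose X0 = X0" "cgcare A B Q S R X0"
  shows "mat_ker R \<subseteq> mat_ker (S + X t ** B)"
proof -
  have ric0: "ric X0 = 0" and ker0: "mat_ker R \<subseteq> mat_ker (S + X0 ** B)"
    using X0(2) by (auto simp: cgcare_def)
  \<comment> \<open>On ker X0 the equation \<open>ric X0 = 0\<close> reduces to X0 A0 r + Q0 r = 0.
    Pairing with r removes the first term, so r . Q0 r = 0, then Q0 r = 0, and finally X0 A0 r =
    0.\<close>
  have inv: "Q0 *v r = 0 \<and> X0 *v (A0 *v r) = 0" if r: "X0 *v r = 0" for r
  proof -
    have *: "ric X0 *v r = X0 *v (A0 *v r) + Q0 *v r"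
      by (simp add: ric_eq mv.add_left mv.diff_left r flip: matrix_vector_mul_assoc)
    have "r \<bullet> (X0 *v (A0 *v r)) = 0"
      using inner_symmetric_swap[OF X0(1), of r "A0 *v r"] r by simp
    then have "r \<bullet> (Q0 *v r) = 0"
      using arg_cong[OF *, of "(\<bullet>) r"] by (simp add: ric0 inner_add_right)
    then have "Q0 *v r = 0" by (rule psd_quadratic_zero[OF psd_Q0])
    then show ?thesis using * ric0 by simp
  qed
  \<comment> \<open>The orthogonal projector onto ker X0. Invariance of the kernel under
    \<open>A0\<close> becomes E A0 E = A0 E, which turns the equation for X E into a linear one in X
    E alone.\<close>
  define E where "E = mat 1 - pinv X0 ** X0"
  have X0E: "X0 *v (E *v v) = 0" for v
    using is_pinv_pinv_symmetric[OF X0(1)]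
    by (simp add: E_def is_pinv_def matrix_algebra)
  have Eid: "E *v r = r" if "X0 *v r = 0" for r
    using that by (simp add: E_def mv.diff_left flip: matrix_vector_mul_assoc)
  have Q0E: "Q0 ** E = 0" and AE: "E ** A0 ** E = A0 ** E"
    using inv[OF X0E] Eid by (simp_all add: matrix_eq flip: matrix_vector_mul_assoc)
  have XE: "X t ** E = 0"
  proof (rule matrix_linear_ode_zero[where f = "\<lambda>t. X t ** E" and T = t
        and K = "\<lambda>t. A0 ** E" and M = "\<lambda>t. transpose A0 - X t ** N"])
    note dX = riccati_flow_derivative[OF X]
    have "ric (X s) ** E = (X s ** E) ** (A0 ** E) + (transpose A0 - X s ** N) ** (X s ** E)" for s
      by (simp add: ric_eq mm.add_left mm.diff_left Q0E AE flip: matrix_mul_assoc)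
         (simp add: matrix_mul_assoc[of E] AE)
    then show "((\<lambda>t. X t ** E) has_vector_derivative
        (X s ** E) ** (A0 ** E) + (transpose A0 - X s ** N) ** (X s ** E)) (at s within {0..t})"
      if "s \<in> {0..t}" for s
      using bounded_linear.has_vector_derivative[OF mm.bounded_linear_left dX[OF that]] by metis
    have "continuous_on {0..t} X"
      by (rule riccati_flow_continuous[OF X])
    then show "continuous_on {0..t} (\<lambda>t. transpose A0 - X t ** N)"
      by (auto intro!: continuous_intros mm.continuous_on)
    show "X 0 ** E = 0" using X by (simp add: riccati_flow_def)
  qed (use t in auto)
  show ?thesis
  proof
    \<comment> \<open>For v in ker R both S v and (S + X0 B) v vanish, so B v lies in ker X0, where
      X(t) is 0.\<close>
    fix v assume v: "v \<in> mat_ker R"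
    then have "S *v v = 0" "(S + X0 ** B) *v v = 0"
      using mat_ker_R_S ker0 by (auto simp: mat_ker_def)
    then have "X0 *v (B *v v) = 0" by (simp add: mv.add_left matrix_vector_mul_assoc)
    then have "X t *v (B *v v) = (X t ** E) *v (B *v v)"
      by (simp add: Eid flip: matrix_vector_mul_assoc)
    then show "v \<in> mat_ker (S + X t ** B)"
      using \<open>S *v v = 0\<close> XE by (simp add: mat_ker_def mv.add_left flip: matrix_vector_mul_assoc)
  qed
qed

end

section \<open>Square-integrable inputs and the cost\<close>

lemma antiderivative_on_cong:
  assumes "antiderivative_on T F f" "\<And>t. t \<in> {0..T} \<Longrightarrow> f t = g t"
  shows "antiderivative_on T F g"
proof -
  have "g absolutely_integrable_on {0..T}"
    using assms(1) set_integrable_cong[of lebesgue lebesgue "{0..T}" "{0..T}" f g] assms(2)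
    by (simp add: antiderivative_on_def)
  moreover have "integral {0..t} g = integral {0..t} f" if "t \<in> {0..T}" for t
    using assms(2) that by (intro Henstock_Kurzweil_Integration.integral_cong) auto
  ultimately show ?thesis
    unfolding antiderivative_on_def using antiderivative_onD[OF assms(1)] by (metis atLeastAtMost_iff)
qed

lemma antiderivative_on_add:
  assumes "antiderivative_on T F f" "antiderivative_on T G g"
  shows "antiderivative_on T (\<lambda>t. F t + G t) (\<lambda>t. f t + g t)"
  unfolding antiderivative_on_def
proof (intro conjI ballI)
  show "(\<lambda>t. f t + g t) absolutely_integrable_on {0..T}"
    using assms by (intro set_integral_add) (auto simp: antiderivative_on_def)
  fix t assume t: "t \<in> {0..T}"
  have "f integrable_on {0..t}" "g integrable_on {0..t}"
    using antiderivative_on_integrable[OF assms(1), of 0 t] antiderivative_on_integrable[OF assms(2), of 0 t] t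
      set_lebesgue_integral_eq_integral(1) by auto
  then have "integral {0..t} (\<lambda>t. f t + g t) = integral {0..t} f + integral {0..t} g"
    by (rule Henstock_Kurzweil_Integration.integral_add)
  moreover have "F t = F 0 + integral {0..t} f" "G t = G 0 + integral {0..t} g"
    using assms t by (auto intro: antiderivative_onD)
  ultimately show "F t + G t = F 0 + G 0 + integral {0..t} (\<lambda>t. f t + g t)"
    by (metis (no_types, lifting) add.assoc add.left_commute)
qed

lemma sets_lebesgue_Icc: "{a..b::real} \<in> sets lebesgue"
  by simp

text \<open>One horizon at a time, because the cost identities live on [0, T]; measurability refers
  to \<open>lebesgue_on\<close>, so that the closure rules for measurable functions apply
  directly.\<close>

definition square_integrable_on :: "real \<Rightarrow> (real \<Rightarrow> 'a::euclidean_space) \<Rightarrow> bool" where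
  "square_integrable_on T f \<longleftrightarrow>
     f \<in> borel_measurable (lebesgue_on {0..T}) \<and> (\<lambda>t. (norm (f t))\<^sup>2) absolutely_integrable_on {0..T}"

lemma locally_square_integrable_iff:
  "locally_square_integrable u \<longleftrightarrow> (\<forall>T\<ge>0. square_integrable_on T u)"
proof -
  have "set_borel_measurable lebesgue {0..T} u \<longleftrightarrow> u \<in> borel_measurable (lebesgue_on {0..T})" for T
    using borel_measurable_restrict_space_iff[of "{0..T}" lebesgue u]
    by (simp add: set_borel_measurable_def)
  then show ?thesis by (simp add: locally_square_integrable_def square_integrable_on_def)
qed

lemma absolutely_integrable_bounded_by:
  fixes f :: "real \<Rightarrow> 'a::euclidean_space"
  assumes "f \<in> borel_measurable (lebesgue_on {0..T})" "g absolutely_integrable_on {0..T}"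
    and "\<And>t. t \<in> {0..T} \<Longrightarrow> norm (f t) \<le> g t"
  shows "f absolutely_integrable_on {0..T::real}"
proof (rule measurable_bounded_by_integrable_imp_absolutely_integrable)
  show "g integrable_on {0..T}" using assms(2) set_lebesgue_integral_eq_integral(1) by blast
qed (use assms in auto)

lemma square_integrable_on_continuous:
  assumes "continuous_on {0..T} f"
  shows "square_integrable_on T f"
  unfolding square_integrable_on_def
  using continuous_imp_measurable_on_sets_lebesgue[OF assms sets_lebesgue_Icc]
  by (auto intro!: absolutely_integrable_continuous_real continuous_intros assms)

lemma square_integrable_on_add:
  assumes "square_integrable_on T f" "square_integrable_on T g"
  shows "square_integrable_on T (\<lambda>t. f t + g t)"
proof -
  have m: "(\<lambda>t. f t + g t) \<in> borel_measurable (lebesgue_on {0..T})"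
    using assms by (intro borel_measurable_add) (auto simp: square_integrable_on_def)
  have "(\<lambda>t. (norm (f t + g t))\<^sup>2) absolutely_integrable_on {0..T}"
  proof (rule absolutely_integrable_bounded_by)
    show "(\<lambda>t. (norm (f t + g t))\<^sup>2) \<in> borel_measurable (lebesgue_on {0..T})" using m by measurable
    show "(\<lambda>t. 2 * (norm (f t))\<^sup>2 + 2 * (norm (g t))\<^sup>2) absolutely_integrable_on {0..T}"
      using assms by (intro set_integral_add set_integrable_mult_right) (auto simp: square_integrable_on_def)
    have "(norm (a + b))\<^sup>2 \<le> 2 * (norm a)\<^sup>2 + 2 * (norm b)\<^sup>2" for a b :: 'a
    proof -
      have "(norm (a + b))\<^sup>2 \<le> (norm a + norm b)\<^sup>2" by (intro power_mono norm_triangle_ineq) auto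
      also have "\<dots> \<le> 2 * (norm a)\<^sup>2 + 2 * (norm b)\<^sup>2"
        using zero_le_power2[of "norm a - norm b"] by (simp add: power2_eq_square algebra_simps)
      finally show ?thesis .
    qed
    then show "norm ((norm (f t + g t))\<^sup>2) \<le> 2 * (norm (f t))\<^sup>2 + 2 * (norm (g t))\<^sup>2" for t by simp
  qed
  then show ?thesis using m by (simp add: square_integrable_on_def)
qed

lemma square_integrable_on_linear:
  assumes f: "square_integrable_on T f" and h: "bounded_linear h"
  shows "square_integrable_on T (\<lambda>t. h (f t))"
proof -
  obtain K where K: "\<And>x. norm (h x) \<le> norm x * K" using bounded_linear.bounded[OF h] by blast
  have m: "(\<lambda>t. h (f t)) \<in> borel_measurable (lebesgue_on {0..T})"
    using f measurable_compose[OF _ borel_measurable_continuous_onI[OF linear_continuous_on[OF h]]]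
    by (auto simp: square_integrable_on_def)
  have "(\<lambda>t. (norm (h (f t)))\<^sup>2) absolutely_integrable_on {0..T}"
  proof (rule absolutely_integrable_bounded_by)
    show "(\<lambda>t. (norm (h (f t)))\<^sup>2) \<in> borel_measurable (lebesgue_on {0..T})" using m by measurable
    show "(\<lambda>t. K\<^sup>2 * (norm (f t))\<^sup>2) absolutely_integrable_on {0..T}"
      using f by (intro set_integrable_mult_right) (auto simp: square_integrable_on_def)
    show "norm ((norm (h (f t)))\<^sup>2) \<le> K\<^sup>2 * (norm (f t))\<^sup>2" for t
      using power_mono[OF K[of "f t"], of 2] by (simp add: power_mult_distrib mult.commute)
  qed
  then show ?thesis using m by (simp add: square_integrable_on_def)
qed

lemma square_integrable_on_inner:
  assumes "square_integrable_on T f" "square_integrable_on T g"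
  shows "(\<lambda>t. f t \<bullet> g t) absolutely_integrable_on {0..T}"
proof (rule absolutely_integrable_bounded_by)
  show "(\<lambda>t. f t \<bullet> g t) \<in> borel_measurable (lebesgue_on {0..T})"
    using assms by (intro borel_measurable_inner) (auto simp: square_integrable_on_def)
  show "(\<lambda>t. (norm (f t))\<^sup>2 + (norm (g t))\<^sup>2) absolutely_integrable_on {0..T}"
    using assms by (intro set_integral_add) (auto simp: square_integrable_on_def)
  show "norm (f t \<bullet> g t) \<le> (norm (f t))\<^sup>2 + (norm (g t))\<^sup>2" for t
  proof -
    have "norm (f t \<bullet> g t) \<le> norm (f t) * norm (g t)" by (simp add: Cauchy_Schwarz_ineq2)
    also have "\<dots> \<le> (norm (f t))\<^sup>2 + (norm (g t))\<^sup>2"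
      using sum_squares_bound[of "norm (f t)" "norm (g t)"] mult_nonneg_nonneg[OF norm_ge_zero[of "f t"] norm_ge_zero[of "g t"]]
      by (simp only: mult.assoc)
    finally show ?thesis .
  qed
qed

lemma square_integrable_on_absolutely_integrable:
  assumes "square_integrable_on T f"
  shows "f absolutely_integrable_on {0..T}"
proof (rule absolutely_integrable_bounded_by)
  show "(\<lambda>t. 1 + (norm (f t))\<^sup>2) absolutely_integrable_on {0..T}"
    using assms by (intro set_integral_add(1)[OF absolutely_integrable_continuous_real[OF continuous_on_const]])
      (simp add: square_integrable_on_def)
  show "norm (f t) \<le> 1 + (norm (f t))\<^sup>2" for t
    using sum_squares_bound[of 1 "norm (f t)"] norm_ge_zero[of "f t"] by (simp only: power_one mult_1_right)
qed (use assms in \<open>simp add: square_integrable_on_def\<close>)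

section \<open>Cost bounds along admissible trajectories\<close>

context lq begin

lemma admissible_antiderivative:
  assumes "admissible A B x0 u x" "0 \<le> T"
  shows "antiderivative_on T x (\<lambda>s. A *v x s + B *v u s)" "x 0 = x0"
proof -
  have int: "(\<lambda>s. A *v x s + B *v u s) absolutely_integrable_on {0..t}"
    and x: "x t = x0 + integral {0..t} (\<lambda>s. A *v x s + B *v u s)" if "0 \<le> t" for t
    using assms(1) that by (auto simp: admissible_def state_trajectory_def set_lebesgue_integral_eq_integral(2))
  show x0: "x 0 = x0" using x[of 0] by simp
  show "antiderivative_on T x (\<lambda>s. A *v x s + B *v u s)"
    unfolding antiderivative_on_def x0 using int[OF assms(2)] x by auto
qed

lemma admissible_square_integrable:
  assumes "admissible A B x0 u x" "0 \<le> T"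
  shows "square_integrable_on T u" "square_integrable_on T x"
  using assms antiderivative_on_continuous[OF admissible_antiderivative(1)[OF assms]]
  by (auto simp: admissible_def locally_square_integrable_iff intro: square_integrable_on_continuous)

lemma ell_integrable:
  assumes "admissible A B x0 u x" "0 \<le> T"
  shows "(\<lambda>t. ell (x t) (u t)) absolutely_integrable_on {0..T}"
  unfolding ell_eq using admissible_square_integrable[OF assms]
  by (intro set_integral_add set_integrable_mult_right square_integrable_on_inner
      square_integrable_on_linear[OF _ mv.bounded_linear_right])

lemma quadratic_R_integrable:
  assumes "square_integrable_on T w"
  shows "(\<lambda>t. w t \<bullet> (R *v w t)) absolutely_integrable_on {0..T}"
  by (intro square_integrable_on_inner square_integrable_on_linear[OF _ mv.bounded_linear_right] assms)

text \<open>Integrability need not be assumed, since the integral of a non-integrable function is 0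
  by convention.\<close>

lemma quadratic_R_integral_nonneg: "0 \<le> integral {s..t} (\<lambda>t. w t \<bullet> (R *v w t))"
proof (cases "(\<lambda>t. w t \<bullet> (R *v w t)) integrable_on {s..t}")
  case True
  then show ?thesis
    using psd_R by (intro Henstock_Kurzweil_Integration.integral_nonneg) (auto simp: psd_def)
qed (simp add: not_integrable_integral)

text \<open>\<open>completion_of_squares\<close> integrated along the trajectory, where Z' = -
  \<open>ric Z\<close> absorbs the Riccati term. It serves both the time-reversed flow and a
  constant \<open>Z\<close> that solves CGCARE.\<close>

lemma cost_identity:
  fixes Z :: "real \<Rightarrow> real^'n^'n"
  assumes adm: "admissible A B x0 u x" and T: "0 \<le> T"
    and dZ: "\<And>t. t \<in> {0..T} \<Longrightarrow> (Z has_vector_derivative - ric (Z t)) (at t within {0..T})"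
    and sym: "\<And>t. t \<in> {0..T} \<Longrightarrow> transpose (Z t) = Z t"
    and ker: "\<And>t. t \<in> {0..T} \<Longrightarrow> mat_ker R \<subseteq> mat_ker (S + Z t ** B)"
  defines "w \<equiv> \<lambda>t. u t + gain (Z t) *v x t"
  shows "square_integrable_on T w"
    and "integral {0..T} (\<lambda>t. ell (x t) (u t))
       = x0 \<bullet> (Z 0 *v x0) - x T \<bullet> (Z T *v x T) + integral {0..T} (\<lambda>t. w t \<bullet> (R *v w t))"
proof -
  note ad = admissible_antiderivative[OF adm T]
  have contZ: "continuous_on {0..T} Z"
    unfolding continuous_on_eq_continuous_within using has_vector_derivative_continuous[OF dZ] by blast
  have contx: "continuous_on {0..T} x" by (rule antiderivative_on_continuous[OF ad(1)])
  show w: "square_integrable_on T w"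
    unfolding w_def gain_def
    by (intro square_integrable_on_add admissible_square_integrable[OF adm T] square_integrable_on_continuous
        mv.continuous_on mm.continuous_on continuous_intros contZ contx)
  have cont: "continuous_on {0..T} (\<lambda>t. - ric (Z t))"
    unfolding ric_eq by (intro continuous_intros mm.continuous_on contZ)
  note aZ = antiderivative_on_C1[OF dZ cont]
  note aZx = antiderivative_on_prod[OF bounded_bilinear_matrix_vector_mult aZ ad(1)]
  note aq = antiderivative_on_prod[OF bounded_bilinear_inner ad(1) aZx]
  have "antiderivative_on T (\<lambda>t. x t \<bullet> (Z t *v x t)) (\<lambda>t. w t \<bullet> (R *v w t) - ell (x t) (u t))"
  proof (rule antiderivative_on_cong[OF aq])
    fix t assume t: "t \<in> {0..T}"
    \<comment> \<open>Symmetry of \<open>Z t\<close> merges the two terms of the product rule that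
      contain x'.\<close>
    have "(A *v x t + B *v u t) \<bullet> (Z t *v x t) = x t \<bullet> (Z t *v (A *v x t + B *v u t))"
      by (metis inner_commute inner_symmetric_swap sym[OF t])
    then show "x t \<bullet> (Z t *v (A *v x t + B *v u t) + - ric (Z t) *v x t) + (A *v x t + B *v u t) \<bullet> (Z t *v x t)
        = w t \<bullet> (R *v w t) - ell (x t) (u t)"
      using completion_of_squares[OF sym[OF t] ker[OF t], of "x t" "u t"]
      by (simp add: w_def mv.minus_left inner_diff_right inner_add_right del: mv.add_right)
  qed
  from antiderivative_onD[OF this T order_refl]
  have "x T \<bullet> (Z T *v x T) = x0 \<bullet> (Z 0 *v x0) + integral {0..T} (\<lambda>t. w t \<bullet> (R *v w t) - ell (x t) (u t))"
    by (simp add: ad(2))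
  also have "integral {0..T} (\<lambda>t. w t \<bullet> (R *v w t) - ell (x t) (u t))
      = integral {0..T} (\<lambda>t. w t \<bullet> (R *v w t)) - integral {0..T} (\<lambda>t. ell (x t) (u t))"
    using quadratic_R_integrable[OF w] ell_integrable[OF adm T] set_lebesgue_integral_eq_integral(1)
    by (intro Henstock_Kurzweil_Integration.integral_diff) auto
  finally show "integral {0..T} (\<lambda>t. ell (x t) (u t))
       = x0 \<bullet> (Z 0 *v x0) - x T \<bullet> (Z T *v x T) + integral {0..T} (\<lambda>t. w t \<bullet> (R *v w t))" by simp
qed

lemma nn_integral_ell:
  assumes "admissible A B x0 u x" "0 \<le> T"
  shows "(\<integral>\<^sup>+ t\<in>{0..T}. ennreal (ell (x t) (u t)) \<partial>lebesgue) = ennreal (integral {0..T} (\<lambda>t. ell (x t) (u t)))"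
proof -
  note i = ell_integrable[OF assms]
  have "(\<integral>\<^sup>+ t\<in>{0..T}. ennreal (ell (x t) (u t)) \<partial>lebesgue)
      = (\<integral>\<^sup>+ t. ennreal (indicator {0..T} t *\<^sub>R ell (x t) (u t)) \<partial>lebesgue)"
    by (intro nn_integral_cong) (auto split: split_indicator)
  also have "\<dots> = ennreal (LINT t:{0..T}|lebesgue. ell (x t) (u t))"
    using i unfolding set_integrable_def set_lebesgue_integral_def
    by (intro nn_integral_eq_integral) (auto simp: ell_nonneg)
  also have "\<dots> = ennreal (integral {0..T} (\<lambda>t. ell (x t) (u t)))"
    by (simp add: set_lebesgue_integral_eq_integral(2)[OF i])
  finally show ?thesis .
qed

lemma J_infty_eq: "J_infty Q S R x u = (\<integral>\<^sup>+ t\<in>{0..}. ennreal (ell (x t) (u t)) \<partial>lebesgue)"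
  by (simp add: J_infty_def ell_def)

lemma J_infty_ge:
  assumes "admissible A B x0 u x" "0 \<le> T"
  shows "ennreal (integral {0..T} (\<lambda>t. ell (x t) (u t))) \<le> J_infty Q S R x u"
  unfolding nn_integral_ell[OF assms, symmetric] J_infty_eq
  by (intro nn_integral_mono) (auto split: split_indicator)

text \<open>Monotone convergence along the integer horizons [0, n], the running cost being
  nonnegative.\<close>

lemma J_infty_le:
  assumes adm: "admissible A B x0 u x" and le: "\<And>T. 0 \<le> T \<Longrightarrow> integral {0..T} (\<lambda>t. ell (x t) (u t)) \<le> c"
  shows "J_infty Q S R x u \<le> ennreal c"
proof -
  define f where "f n t = ennreal (ell (x t) (u t)) * indicator {0..real n} t" for n t
  have "f n \<in> borel_measurable lebesgue" for n
  proof -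
    have "(\<lambda>t. ennreal (indicator {0..real n} t *\<^sub>R ell (x t) (u t))) \<in> borel_measurable lebesgue"
      using ell_integrable[OF adm, of "real n"] unfolding set_integrable_def
      by (intro measurable_compose[OF _ measurable_ennreal] borel_measurable_integrable) auto
    also have "(\<lambda>t. ennreal (indicator {0..real n} t *\<^sub>R ell (x t) (u t))) = f n"
      by (auto simp: f_def fun_eq_iff split: split_indicator)
    finally show ?thesis .
  qed
  moreover have "incseq f"
    by (auto simp: incseq_def le_fun_def f_def split: split_indicator)
  ultimately have "(\<integral>\<^sup>+ t. (SUP n. f n t) \<partial>lebesgue) = (SUP n. \<integral>\<^sup>+ t. f n t \<partial>lebesgue)"
    by (intro nn_integral_monotone_convergence_SUP)
  moreover have "J_infty Q S R x u \<le> (\<integral>\<^sup>+ t. (SUP n. f n t) \<partial>lebesgue)"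
    unfolding J_infty_eq
  proof (intro nn_integral_mono)
    fix t :: real
    obtain n where "t \<le> real n" using real_arch_simple by blast
    then have "ennreal (ell (x t) (u t)) * indicator {0..} t = f n t" by (simp add: f_def split: split_indicator)
    also have "\<dots> \<le> (SUP n. f n t)" by (intro SUP_upper) auto
    finally show "ennreal (ell (x t) (u t)) * indicator {0..} t \<le> (SUP n. f n t)" .
  qed
  moreover have "(SUP n. \<integral>\<^sup>+ t. f n t \<partial>lebesgue) \<le> ennreal c"
    unfolding f_def using nn_integral_ell[OF adm] le by (intro SUP_least) (simp add: ennreal_leI)
  ultimately show ?thesis by simp
qed

text \<open>Completing the square with \<open>X (T' - t)\<close> on \<open>[0, T]\<close> and \<open>[0, T']\<close> shows that the cost over
  \<open>[T, T']\<close> is at least \<open>x T \<bullet> (X (T' - T) *v x T)\<close>; no time shift of the trajectory is needed.\<close>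

lemma J_infty_ge_flow:
  assumes X: "riccati_flow A B Q S R X" and ker: "\<And>t. 0 \<le> t \<Longrightarrow> mat_ker R \<subseteq> mat_ker (S + X t ** B)"
    and adm: "admissible A B x0 u x" and T: "0 \<le> T" and r: "0 \<le> r"
  shows "ennreal (integral {0..T} (\<lambda>t. ell (x t) (u t)) + x T \<bullet> (X r *v x T)) \<le> J_infty Q S R x u"
proof -
  \<comment> \<open>The reversed flow ends in Z (T + r) = X 0 = 0 and passes through Z T = X
    r.\<close>
  define Z where "Z t = X (T + r - t)" for t
  have dZ: "(Z has_vector_derivative - ric (Z t)) (at t within {0..s})" if s: "s \<le> T + r" and t: "t \<in> {0..s}" for s t
  proof -
    have "(X has_vector_derivative ric (X (T + r - t))) (at (T + r - t) within {0..})"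
      using X s t by (simp add: riccati_flow_def)
    then have "(X has_vector_derivative ric (X (T + r - t))) (at (T + r - t) within (\<lambda>t. T + r - t) ` {0..s})"
      using s by (rule_tac has_vector_derivative_within_subset) auto
    moreover have "((\<lambda>t. T + r - t) has_vector_derivative -1) (at t within {0..s})"
      by (auto intro!: derivative_eq_intros simp: has_real_derivative_iff_has_vector_derivative[symmetric])
    ultimately have "(X \<circ> (\<lambda>t. T + r - t) has_vector_derivative -1 *\<^sub>R ric (X (T + r - t))) (at t within {0..s})"
      by (intro vector_diff_chain_within)
    then show ?thesis by (simp add: Z_def[abs_def] o_def)
  qed
  define w where "w t = u t + gain (Z t) *v x t" for t
  have id: "integral {0..s} (\<lambda>t. ell (x t) (u t))
       = x0 \<bullet> (Z 0 *v x0) - x s \<bullet> (Z s *v x s) + integral {0..s} (\<lambda>t. w t \<bullet> (R *v w t))"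
    and w: "square_integrable_on s w" if "0 \<le> s" "s \<le> T + r" for s
    unfolding w_def using that
    by (intro cost_identity[OF adm] dZ; simp add: Z_def flow_symmetric[OF X] ker)+
  have "(\<lambda>t. w t \<bullet> (R *v w t)) integrable_on {0..T + r}"
    using quadratic_R_integrable[OF w[of "T + r"]] T r set_lebesgue_integral_eq_integral(1) by auto
  then have "integral {0..T} (\<lambda>t. w t \<bullet> (R *v w t)) + integral {T..T + r} (\<lambda>t. w t \<bullet> (R *v w t))
      = integral {0..T + r} (\<lambda>t. w t \<bullet> (R *v w t))"
    using T r by (intro Henstock_Kurzweil_Integration.integral_combine) auto
  moreover have "Z (T + r) = 0" "Z T = X r" using X by (simp_all add: Z_def riccati_flow_def)
  \<comment> \<open>Both identities use the same \<open>Z\<close>, so their terms x0 . Z 0 x0 agree;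
    the difference is the integral of w . R w over [T, T + r], which is nonnegative.\<close>
  ultimately have "integral {0..T} (\<lambda>t. ell (x t) (u t)) + x T \<bullet> (X r *v x T)
      \<le> integral {0..T + r} (\<lambda>t. ell (x t) (u t))"
    using id[of T] id[of "T + r"] T r quadratic_R_integral_nonneg[of T "T + r" w] by simp
  then show ?thesis
    using J_infty_ge[OF adm, of "T + r"] T r by (meson add_nonneg_nonneg ennreal_leI order_trans)
qed

text \<open>For fixed T, letting r tend to infinity in \<open>J_infty_ge_flow\<close> produces the
  term x T . Xbar x T, which cancels exactly against the terminal term of
  \<open>cost_identity\<close> for the constant \<open>Xbar\<close>.\<close>

lemma J_infty_ge_limit:
  assumes X: "riccati_flow A B Q S R X" and ker: "\<And>t. 0 \<le> t \<Longrightarrow> mat_ker R \<subseteq> mat_ker (S + X t ** B)"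
    and lim: "(X \<longlongrightarrow> Xbar) at_top" and Xbar: "psd Xbar" "cgcare A B Q S R Xbar"
    and adm: "admissible A B x0 u x" and T: "0 \<le> T"
  defines "w \<equiv> \<lambda>t. u t + gain Xbar *v x t"
  shows "ennreal (x0 \<bullet> (Xbar *v x0) + integral {0..T} (\<lambda>t. w t \<bullet> (R *v w t))) \<le> J_infty Q S R x u"
proof (cases "J_infty Q S R x u")
  case (real j)
  have "((\<lambda>r. integral {0..T} (\<lambda>t. ell (x t) (u t)) + x T \<bullet> (X r *v x T))
      \<longlongrightarrow> integral {0..T} (\<lambda>t. ell (x t) (u t)) + x T \<bullet> (Xbar *v x T)) at_top"
    by (intro tendsto_intros mv.tendsto lim)
  moreover have "\<forall>\<^sub>F r in at_top. integral {0..T} (\<lambda>t. ell (x t) (u t)) + x T \<bullet> (X r *v x T) \<le> j"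
    using eventually_ge_at_top[of 0]
    by eventually_elim (use J_infty_ge_flow[OF X ker adm T] real in \<open>simp add: ennreal_le_iff\<close>)
  ultimately have "integral {0..T} (\<lambda>t. ell (x t) (u t)) + x T \<bullet> (Xbar *v x T) \<le> j"
    by (rule tendsto_upperbound) simp
  moreover have "integral {0..T} (\<lambda>t. ell (x t) (u t))
       = x0 \<bullet> (Xbar *v x0) - x T \<bullet> (Xbar *v x T) + integral {0..T} (\<lambda>t. w t \<bullet> (R *v w t))"
    unfolding w_def using Xbar
    by (intro cost_identity(2)[OF adm T, where Z = "\<lambda>_. Xbar"]) (auto simp: cgcare_def psd_def)
  ultimately show ?thesis by (simp add: real ennreal_leI)
qed simp

text \<open>Bounds for each single x suffice: the forms x . X(t) x are nondecreasing, hence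
  convergent, and polarisation passes from forms to entries. Symmetry, sign and kernel inclusion are
  closed conditions.\<close>

lemma flow_limit:
  assumes X: "riccati_flow A B Q S R X" and nonneg: "\<And>t x. 0 \<le> t \<Longrightarrow> 0 \<le> x \<bullet> (ric (X t) *v x)"
    and ker: "\<And>t. 0 \<le> t \<Longrightarrow> mat_ker R \<subseteq> mat_ker (S + X t ** B)"
    and bdd: "\<And>x. \<exists>c. \<forall>t\<ge>0. x \<bullet> (X t *v x) \<le> c"
  obtains Xbar where "(X \<longlongrightarrow> Xbar) at_top" "psd Xbar" "cgcare A B Q S R Xbar"
proof -
  have X0: "X 0 = 0" and dX: "\<And>t. 0 \<le> t \<Longrightarrow> (X has_vector_derivative ric (X t)) (at t within {0..})"
    using X by (auto simp: riccati_flow_def)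
  have mono: "x \<bullet> (X s *v x) \<le> x \<bullet> (X t *v x)" if "0 \<le> s" "s \<le> t" for s t x
  proof -
    have "\<exists>r\<in>{s..t}. x \<bullet> (X t *v x) - x \<bullet> (X s *v x) = (\<lambda>h. x \<bullet> ((h *\<^sub>R ric (X r)) *v x)) (t - s)"
    proof (rule mvt_very_simple[OF \<open>s \<le> t\<close>])
      fix r assume r: "s \<le> r" "r \<le> t"
      have "(X has_derivative (\<lambda>h. h *\<^sub>R ric (X r))) (at r within {s..t})"
        using has_vector_derivative_within_subset[OF dX[of r], of "{s..t}"] r that
        by (auto simp: has_vector_derivative_def)
      then show "((\<lambda>t. x \<bullet> (X t *v x)) has_derivative (\<lambda>h. x \<bullet> ((h *\<^sub>R ric (X r)) *v x))) (at r within {s..t})"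
        by (intro bounded_linear.has_derivative[OF bounded_linear_inner_right]
            bounded_linear.has_derivative[OF mv.bounded_linear_left])
    qed
    then obtain r where "r \<in> {s..t}" "x \<bullet> (X t *v x) - x \<bullet> (X s *v x) = (t - s) * (x \<bullet> (ric (X r) *v x))"
      by (auto simp: mv.scaleR_left)
    moreover have "0 \<le> (t - s) * (x \<bullet> (ric (X r) *v x))"
      using \<open>r \<in> {s..t}\<close> that by (intro mult_nonneg_nonneg nonneg) auto
    ultimately show ?thesis by linarith
  qed
  have "\<exists>l. ((\<lambda>t. x \<bullet> (X t *v x)) \<longlongrightarrow> l) at_top" for x
    using mono_bounded_tendsto_at_top[of "\<lambda>t. x \<bullet> (X t *v x)"] mono bdd[of x] by metis
  then obtain l where l: "\<And>x. ((\<lambda>t. x \<bullet> (X t *v x)) \<longlongrightarrow> l x) at_top" by metis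
  \<comment> \<open>Polarisation; the flow is symmetric, so the two mixed terms agree.\<close>
  define m where "m x y = (l (x + y) - l x - l y) / 2" for x y
  have m: "((\<lambda>t. x \<bullet> (X t *v y)) \<longlongrightarrow> m x y) at_top" for x y
  proof (rule Lim_transform_eventually)
    show "((\<lambda>t. ((x + y) \<bullet> (X t *v (x + y)) - x \<bullet> (X t *v x) - y \<bullet> (X t *v y)) / 2) \<longlongrightarrow> m x y) at_top"
      unfolding m_def by (intro tendsto_intros l) simp
    show "\<forall>\<^sub>F t in at_top. ((x + y) \<bullet> (X t *v (x + y)) - x \<bullet> (X t *v x) - y \<bullet> (X t *v y)) / 2 = x \<bullet> (X t *v y)"
      using eventually_ge_at_top[of 0]
    proof eventually_elim
      case (elim t)
      have "y \<bullet> (X t *v x) = x \<bullet> (X t *v y)"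
        by (metis elim flow_symmetric[OF X] inner_commute inner_symmetric_swap)
      then show ?case by (simp add: mv.add_right inner_add_left inner_add_right)
    qed
  qed
  define Xbar where "Xbar = (\<chi> i j. m (axis i 1) (axis j 1) :: real^'n^'n)"
  have lim: "(X \<longlongrightarrow> Xbar) at_top"
  proof (intro vec_tendstoI)
    fix i j
    have "X t $ i $ j = axis i 1 \<bullet> (X t *v axis j 1)" for t
      by (simp add: matrix_vector_mul_component inner_axis' inner_axis)
    then show "((\<lambda>t. X t $ i $ j) \<longlongrightarrow> Xbar $ i $ j) at_top"
      using m[of "axis i 1" "axis j 1"] by (simp add: Xbar_def)
  qed
  have sym: "transpose Xbar = Xbar"
  proof (rule tendsto_unique[OF _ _ lim])
    have "((\<lambda>t. transpose (X t)) \<longlongrightarrow> transpose Xbar) at_top"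
      by (rule bounded_linear.tendsto[OF bounded_linear_transpose lim])
    moreover have "\<forall>\<^sub>F t in at_top. transpose (X t) = X t"
      using eventually_ge_at_top[of 0] by eventually_elim (rule flow_symmetric[OF X])
    ultimately show "(X \<longlongrightarrow> transpose Xbar) at_top" by (rule Lim_transform_eventually)
  qed simp
  have "0 \<le> x \<bullet> (Xbar *v x)" for x
  proof (rule tendsto_lowerbound)
    show "((\<lambda>t. x \<bullet> (X t *v x)) \<longlongrightarrow> x \<bullet> (Xbar *v x)) at_top" by (intro tendsto_intros mv.tendsto lim)
    show "\<forall>\<^sub>F t in at_top. 0 \<le> x \<bullet> (X t *v x)"
      using eventually_ge_at_top[of 0] by eventually_elim (use mono[of 0] X0 in fastforce)
  qed simp
  then have psd: "psd Xbar" using sym by (simp add: psd_def)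
  have "ric Xbar = 0"
  proof -
    let ?M = "ric Xbar"
    have limM: "((\<lambda>t. ric (X t)) \<longlongrightarrow> ?M) at_top"
      unfolding ric_eq by (intro tendsto_intros mm.tendsto lim)
    \<comment> \<open>Pairing the flow with M = \<open>ric Xbar\<close> in the entrywise inner
      product gives a convergent real function whose derivative tends to M . M.\<close>
    have "?M \<bullet> ?M = 0"
    proof (rule limit_derivative_zero[where g = "\<lambda>t. X t \<bullet> ?M" and g' = "\<lambda>t. ric (X t) \<bullet> ?M"])
      show "((\<lambda>t. X t \<bullet> ?M) has_real_derivative ric (X t) \<bullet> ?M) (at t within {0..})" if "0 \<le> t" for t
        using bounded_linear.has_vector_derivative[OF bounded_linear_inner_left dX[OF that]]
        by (simp add: has_real_derivative_iff_has_vector_derivative)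
      show "((\<lambda>t. X t \<bullet> ?M) \<longlongrightarrow> Xbar \<bullet> ?M) at_top" "((\<lambda>t. ric (X t) \<bullet> ?M) \<longlongrightarrow> ?M \<bullet> ?M) at_top"
        by (intro tendsto_intros lim limM)+
    qed
    then show ?thesis by simp
  qed
  moreover have "mat_ker R \<subseteq> mat_ker (S + Xbar ** B)"
  proof
    fix v assume v: "v \<in> mat_ker R"
    have "((\<lambda>t. (S + X t ** B) *v v) \<longlongrightarrow> (S + Xbar ** B) *v v) at_top"
      by (intro tendsto_intros mv.tendsto mm.tendsto lim)
    moreover have "\<forall>\<^sub>F t in at_top. (S + X t ** B) *v v = 0"
      using eventually_ge_at_top[of 0] by eventually_elim (use ker v in \<open>auto simp: mat_ker_def\<close>)
    ultimately have "((\<lambda>t::real. 0) \<longlongrightarrow> (S + Xbar ** B) *v v) at_top"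
      by (rule Lim_transform_eventually)
    then show "v \<in> mat_ker (S + Xbar ** B)"
      by (simp add: tendsto_const_iff mat_ker_def)
  qed
  ultimately show ?thesis using that lim psd by (simp add: cgcare_def)
qed

section \<open>Closed-loop controls and optimality\<close>

text \<open>The closed loop x' = K x + b has a forcing b that is only integrable. Writing x = y + g
  with g the integral of b leaves y' = K y + K g, whose forcing is continuous, so that a classical
  solution exists.\<close>

lemma feedback_ex:
  assumes v: "locally_square_integrable v"
  obtains u x where "admissible A B x0 u x" "\<And>t. u t = - gain X *v x t + (mat 1 - P ** R) *v v t"
proof -
  define K where "K = A - B ** gain X"
  define b where "b t = B *v ((mat 1 - P ** R) *v v t)" for t
  have vT: "square_integrable_on T v" if "0 \<le> T" for T
    using v that by (simp add: locally_square_integrable_iff)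
  have b: "b absolutely_integrable_on {0..T}" if "0 \<le> T" for T
    unfolding b_def using vT[OF that]
    by (intro square_integrable_on_absolutely_integrable square_integrable_on_linear[OF _ mv.bounded_linear_right])
  define g where "g t = integral {0..t} b" for t
  have g: "antiderivative_on T g b" if "0 \<le> T" for T
    using b[OF that] by (simp add: antiderivative_on_def g_def)
  have contg: "continuous_on {0..T} g" if "0 \<le> T" for T
    by (rule antiderivative_on_continuous[OF g[OF that]])
  obtain y where y: "y 0 = x0"
    "\<And>T t. 0 \<le> T \<Longrightarrow> t \<in> {0..T} \<Longrightarrow> (y has_vector_derivative K *v y t + K *v g t) (at t within {0..T})"
    using forced_linear_ode_ex[of "\<lambda>t. K *v g t" x0 K, OF mv.continuous_on[OF continuous_on_const contg]] by blast
  define x where "x t = y t + g t" for t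
  define u where "u t = - gain X *v x t + (mat 1 - P ** R) *v v t" for t
  have x0: "x 0 = x0" by (simp add: x_def g_def y(1))
  have x: "antiderivative_on T x (\<lambda>t. A *v x t + B *v u t)" if "0 \<le> T" for T
  proof -
    have "continuous_on {0..T} y"
      unfolding continuous_on_eq_continuous_within using has_vector_derivative_continuous[OF y(2)] that by blast
    then have "continuous_on {0..T} (\<lambda>t. K *v y t + K *v g t)"
      by (intro continuous_intros mv.continuous_on contg that)
    then have "antiderivative_on T y (\<lambda>t. K *v y t + K *v g t)"
      by (intro antiderivative_on_C1 y(2) that)
    from antiderivative_on_add[OF this g[OF that]]
    have "antiderivative_on T x (\<lambda>t. K *v y t + K *v g t + b t)" by (simp add: x_def[abs_def])
    then show ?thesis
      by (rule antiderivative_on_cong)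
         (simp add: x_def u_def b_def K_def mv.add_right mv.diff_left mv.minus_left mv.minus_right
           mv.diff_right flip: matrix_vector_mul_assoc)
  qed
  have "locally_square_integrable u"
    unfolding locally_square_integrable_iff u_def
    by (intro allI impI square_integrable_on_add square_integrable_on_linear[OF vT mv.bounded_linear_right]
        square_integrable_on_continuous[OF mv.continuous_on[OF continuous_on_const antiderivative_on_continuous[OF x]]])
  moreover have "state_trajectory A B x0 u x"
    unfolding state_trajectory_def
  proof (intro allI impI conjI)
    fix t :: real assume t: "0 \<le> t"
    show i: "set_integrable lebesgue {0..t} (\<lambda>s. A *v x s + B *v u s)"
      using x[OF t] by (simp add: antiderivative_on_def)
    show "x t = x0 + (LINT s:{0..t}|lebesgue. A *v x s + B *v u s)"
      using antiderivative_onD[OF x[OF t] t order_refl] set_lebesgue_integral_eq_integral(2)[OF i] x0 by simp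
  qed
  ultimately show ?thesis using that[of u x] by (simp add: admissible_def u_def)
qed

text \<open>Here w = u + \<open>gain X\<close> x equals v - P R v almost everywhere, which R
  annihilates. The cost up to T is thus x0 . X x0 minus a nonnegative terminal term.\<close>

lemma feedback_cost_le:
  assumes adm: "admissible A B x0 u x" and X: "psd X" "cgcare A B Q S R X"
    and u: "AE t in lebesgue. 0 \<le> t \<longrightarrow> u t = - gain X *v x t + (mat 1 - P ** R) *v v t"
  shows "J_infty Q S R x u \<le> ennreal (x0 \<bullet> (X *v x0))"
proof (rule J_infty_le[OF adm])
  fix T :: real assume T: "0 \<le> T"
  define w where "w t = u t + gain X *v x t" for t
  have id: "integral {0..T} (\<lambda>t. ell (x t) (u t))
       = x0 \<bullet> (X *v x0) - x T \<bullet> (X *v x T) + integral {0..T} (\<lambda>t. w t \<bullet> (R *v w t))"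
    and w: "square_integrable_on T w"
    unfolding w_def using X
    by (intro cost_identity[OF adm T, where Z = "\<lambda>_. X"]; force simp: cgcare_def psd_def)+
  have "AE t in lebesgue. indicator {0..T} t *\<^sub>R (w t \<bullet> (R *v w t)) = 0"
    using u
  proof eventually_elim
    case (elim t)
    then have "w t = v t - P *v (R *v v t)" if "0 \<le> t"
      using that by (simp add: w_def mv.minus_left mv.diff_left flip: matrix_vector_mul_assoc)
    then show ?case by (simp add: mv.diff_right R_P_R split: split_indicator)
  qed
  then have "(LINT t:{0..T}|lebesgue. w t \<bullet> (R *v w t)) = 0"
    unfolding set_lebesgue_integral_def by (rule integral_eq_zero_AE)
  then have "integral {0..T} (\<lambda>t. w t \<bullet> (R *v w t)) = 0"
    using set_lebesgue_integral_eq_integral(2)[OF quadratic_R_integrable[OF w]] by simp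
  then show "integral {0..T} (\<lambda>t. ell (x t) (u t)) \<le> x0 \<bullet> (X *v x0)"
    using id X(1) by (simp add: psd_def)
qed

text \<open>The deviation w from the feedback law can itself serve as \<open>v\<close>: a vanishing
  integral of w . R w gives R w = 0 almost everywhere, and then w = (I - P R) w.\<close>

lemma feedback_if_no_excess:
  assumes adm: "admissible A B x0 u x"
    and zero: "\<And>T. 0 \<le> T \<Longrightarrow> integral {0..T} (\<lambda>t. (u t + gain X *v x t) \<bullet> (R *v (u t + gain X *v x t))) \<le> 0"
  shows "\<exists>v. locally_square_integrable v \<and>
    (AE t in lebesgue. 0 \<le> t \<longrightarrow> u t = - gain X *v x t + (mat 1 - P ** R) *v v t)"
proof -
  define w where "w t = u t + gain X *v x t" for t
  have w: "square_integrable_on T w" if T: "0 \<le> T" for T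
    unfolding w_def
    by (intro square_integrable_on_add square_integrable_on_linear[OF _ mv.bounded_linear_right]
        admissible_square_integrable[OF adm T])
  have nn: "0 \<le> w t \<bullet> (R *v w t)" for t using psd_R by (simp add: psd_def)
  \<comment> \<open>Integer horizons keep the family of exceptional null sets countable.\<close>
  have "AE t in lebesgue. indicator {0..real n} t *\<^sub>R (w t \<bullet> (R *v w t)) = 0" for n
  proof -
    note i = quadratic_R_integrable[OF w[of "real n"], simplified]
    have "(LINT t:{0..real n}|lebesgue. w t \<bullet> (R *v w t)) = 0"
      using set_lebesgue_integral_eq_integral(2)[OF i] zero[of "real n"] quadratic_R_integral_nonneg[of 0 "real n" w]
      by (simp add: w_def)
    then show ?thesis
      using i nn unfolding set_integrable_def set_lebesgue_integral_def
      by (subst (asm) integral_nonneg_eq_0_iff_AE) auto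
  qed
  then have "AE t in lebesgue. \<forall>n. indicator {0..real n} t *\<^sub>R (w t \<bullet> (R *v w t)) = 0"
    unfolding AE_all_countable by blast
  then have "AE t in lebesgue. 0 \<le> t \<longrightarrow> u t = - gain X *v x t + (mat 1 - P ** R) *v w t"
  proof eventually_elim
    case (elim t)
    show ?case
    proof
      assume t: "0 \<le> t"
      obtain n where "t \<le> real n" using real_arch_simple by blast
      then have "w t \<bullet> (R *v w t) = 0" using elim[rule_format, of n] t by simp
      then have "R *v w t = 0" by (rule psd_quadratic_zero[OF psd_R])
      then show "u t = - gain X *v x t + (mat 1 - P ** R) *v w t"
        by (simp add: mv.diff_left mv.minus_left w_def[of t] flip: matrix_vector_mul_assoc)
    qed
  qed
  moreover have "locally_square_integrable w" using w by (simp add: locally_square_integrable_iff)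
  ultimately show ?thesis by blast
qed

end

theorem theorem3p2:
  fixes A Q :: "real^'n^'n" and B S :: "real^'m^'n" and R :: "real^'m^'m"
  assumes "psd (popov Q S R)"
    and "\<exists>X. transpose X = X \<and> cgcare A B Q S R X"
    and "\<forall>x0. \<exists>u x. admissible A B x0 u x \<and> J_infty Q S R x u < \<infinity>"
  shows "\<exists>X. riccati_flow A B Q S R X \<and>
           (\<forall>Y. riccati_flow A B Q S R Y \<longrightarrow> (\<forall>t\<ge>0. Y t = X t)) \<and>
           (\<exists>Xbar. (X \<longlongrightarrow> Xbar) at_top \<and> psd Xbar \<and> cgcare A B Q S R Xbar \<and>
              (\<forall>x0. (\<exists>u x. admissible A B x0 u x \<and>
                          J_infty Q S R x u = ennreal (x0 \<bullet> (Xbar *v x0))) \<and>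
                    (\<forall>u x. admissible A B x0 u x \<longrightarrow>
                          ennreal (x0 \<bullet> (Xbar *v x0)) \<le> J_infty Q S R x u)) \<and>
              (\<forall>Xt. psd Xt \<and> cgcare A B Q S R Xt \<longrightarrow> psd_le Xbar Xt) \<and>
              (\<forall>x0. {u. optimal_control A B Q S R x0 u} =
                      {u. \<exists>v. locally_square_integrable v \<and>
                              feedback_control A B S R Xbar x0 v u} \<and>
                    (\<forall>v. locally_square_integrable v \<longrightarrow>
                         (\<exists>u. feedback_control A B S R Xbar x0 v u))))"
proof -
  interpret lq A Q B S R by unfold_locales (rule assms(1))
  obtain X0 where X0: "transpose X0 = X0" "cgcare A B Q S R X0" using assms(2) by blast
  obtain X where X: "riccati_flow A B Q S R X"
    and nonneg: "\<And>t x. 0 \<le> t \<Longrightarrow> 0 \<le> x \<bullet> (ric (X t) *v x)" using flow_ex by blast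
  have ker: "mat_ker R \<subseteq> mat_ker (S + X t ** B)" if "0 \<le> t" for t by (rule flow_ker[OF X that X0])
  \<comment> \<open>With T = 0 in \<open>J_infty_ge_flow\<close>, the finite cost of a single
    control bounds x0 . X(t) x0 for all t at once.\<close>
  have "\<exists>c. \<forall>t\<ge>0. x0 \<bullet> (X t *v x0) \<le> c" for x0
  proof -
    obtain u x where adm: "admissible A B x0 u x" and "J_infty Q S R x u < \<infinity>" using assms(3) by blast
    then obtain j where j: "0 \<le> j" "J_infty Q S R x u = ennreal j"
      by (cases "J_infty Q S R x u") auto
    have "x0 \<bullet> (X t *v x0) \<le> j" if "0 \<le> t" for t
      using J_infty_ge_flow[OF X ker adm order_refl that] j admissible_antiderivative(2)[OF adm order_refl]
      by (simp add: ennreal_le_iff)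
    then show ?thesis by blast
  qed
  from flow_limit[OF X nonneg ker this] obtain Xbar
    where lim: "(X \<longlongrightarrow> Xbar) at_top" and Xbar: "psd Xbar" "cgcare A B Q S R Xbar" by blast
  have lower: "ennreal (x0 \<bullet> (Xbar *v x0) + integral {0..T} (\<lambda>t. (u t + gain Xbar *v x t) \<bullet> (R *v (u t + gain Xbar *v x t))))
      \<le> J_infty Q S R x u" if "admissible A B x0 u x" "0 \<le> T" for x0 u x T
    by (rule J_infty_ge_limit[OF X _ lim Xbar that]) (rule ker)
  have lower0: "ennreal (x0 \<bullet> (Xbar *v x0)) \<le> J_infty Q S R x u" if "admissible A B x0 u x" for x0 u x
    using lower[OF that order_refl] by simp
  \<comment> \<open>The free signal is taken to be 0. The general \<open>Xt\<close> serves
    minimality, the instance \<open>Xbar\<close> serves attainment of the optimal value.\<close>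
  have attained: "\<exists>u x. admissible A B x0 u x \<and> J_infty Q S R x u \<le> ennreal (x0 \<bullet> (Xt *v x0))"
    if "psd Xt" "cgcare A B Q S R Xt" for x0 Xt
  proof -
    have "locally_square_integrable (\<lambda>t. 0 :: real^'m)"
      by (simp add: locally_square_integrable_iff square_integrable_on_continuous)
    then obtain u x where "admissible A B x0 u x" "\<And>t. u t = - gain Xt *v x t + (mat 1 - P ** R) *v 0"
      using feedback_ex[where X = Xt] by blast
    then show ?thesis using feedback_cost_le[where v = "\<lambda>_. 0", OF _ that] by blast
  qed
  have minimal: "psd_le Xbar Xt" if Xt: "psd Xt" "cgcare A B Q S R Xt" for Xt
  proof -
    have "x0 \<bullet> (Xbar *v x0) \<le> x0 \<bullet> (Xt *v x0)" for x0
    proof -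
      obtain u x where "admissible A B x0 u x" "J_infty Q S R x u \<le> ennreal (x0 \<bullet> (Xt *v x0))"
        using attained[OF Xt] by blast
      then have "ennreal (x0 \<bullet> (Xbar *v x0)) \<le> ennreal (x0 \<bullet> (Xt *v x0))" using lower0 order_trans by blast
      then show ?thesis using Xt(1) by (simp add: psd_def ennreal_le_iff)
    qed
    then show ?thesis
      using Xt(1) Xbar(1) by (simp add: psd_le_def psd_def transpose_diff mv.diff_left inner_diff_right)
  qed
  have feedback_iff: "feedback_control A B S R Xbar x0 v u \<longleftrightarrow> (\<exists>x. admissible A B x0 u x \<and>
      (AE t in lebesgue. 0 \<le> t \<longrightarrow> u t = - gain Xbar *v x t + (mat 1 - P ** R) *v v t))" for x0 v u
    by (simp add: feedback_control_def gain_def)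
  have "optimal_control A B Q S R x0 u \<longleftrightarrow>
      (\<exists>v. locally_square_integrable v \<and> feedback_control A B S R Xbar x0 v u)" for x0 u
  proof
    assume "optimal_control A B Q S R x0 u"
    then obtain x where adm: "admissible A B x0 u x"
      and opt: "\<And>u' x'. admissible A B x0 u' x' \<Longrightarrow> J_infty Q S R x u \<le> J_infty Q S R x' u'"
      by (auto simp: optimal_control_def)
    have "J_infty Q S R x u \<le> ennreal (x0 \<bullet> (Xbar *v x0))"
      using attained[OF Xbar] opt order_trans by blast
    \<comment> \<open>The value x0 . Xbar x0 plus the integral of w . R w is at most the cost, which
      is at most x0 . Xbar x0.\<close>
    note upper = order_trans[OF lower[OF adm] this]
    have "integral {0..T} (\<lambda>t. (u t + gain Xbar *v x t) \<bullet> (R *v (u t + gain Xbar *v x t))) \<le> 0"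
      if "0 \<le> T" for T
      using upper[OF that] Xbar(1) by (simp add: psd_def ennreal_le_iff)
    from feedback_if_no_excess[OF adm this]
    show "\<exists>v. locally_square_integrable v \<and> feedback_control A B S R Xbar x0 v u"
      using adm unfolding feedback_iff by blast
  next
    assume "\<exists>v. locally_square_integrable v \<and> feedback_control A B S R Xbar x0 v u"
    then obtain v x where "admissible A B x0 u x"
      "AE t in lebesgue. 0 \<le> t \<longrightarrow> u t = - gain Xbar *v x t + (mat 1 - P ** R) *v v t"
      unfolding feedback_iff by blast
    then show "optimal_control A B Q S R x0 u"
      unfolding optimal_control_def using feedback_cost_le[OF _ Xbar] lower0 order_trans by blast
  qed
  moreover have "\<exists>u. feedback_control A B S R Xbar x0 v u" if v: "locally_square_integrable v" for v x0
  proof -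
    obtain u x where ux: "admissible A B x0 u x" "\<And>t. u t = - gain Xbar *v x t + (mat 1 - P ** R) *v v t"
      using feedback_ex[OF v] by blast
    have "AE t in lebesgue. 0 \<le> t \<longrightarrow> u t = - gain Xbar *v x t + (mat 1 - P ** R) *v v t"
      by (rule AE_I2) (simp add: ux(2))
    then show ?thesis unfolding feedback_iff using ux(1) by blast
  qed
  moreover have "\<exists>u x. admissible A B x0 u x \<and> J_infty Q S R x u = ennreal (x0 \<bullet> (Xbar *v x0))" for x0
    using attained[OF Xbar] lower0 antisym by blast
  ultimately show ?thesis
    using lower0 minimal flow_unique[OF X]
    by (intro exI[of _ X] conjI exI[of _ Xbar] X lim Xbar allI impI Collect_cong) blast+
qed

end
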